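(* Let $\tau_q$ be the packet transmission time, $N$ the number of packets per block, $\mathrm{P}_{\rm B}$ Bob's packet success probability, $T_{\rm ack}$ the acknowledgment delay in time slots, and $\mathrm{P}_{\rm asy}$ the probability of an asynchronization incidence for Eve in a block. The expected time $\tau_{\rm asy}$ to the first asynchronization incidence, equivalently the expected interval between two consecutive incidences, is $$\tau_{\rm asy}=\frac{\tau_q}{\mathrm{P}_{\rm asy}}\left(\frac{N+1.6}{\mathrm{P}_{\rm B}}+\mathbb{E}[T_{\rm ack}]\right).$$
   Context: Random linear network coding model over $\mathbb{F}_2$. Transmission proceeds in successive blocks; the blocks are statistically identical and independent. Within a block, Alice transmits one coded packet per time slot $t=1,2,\ldots$, each slot lasting $\tau_q$ units of time, with a coding vector $\mathbf{a}_t\in\mathbb{F}_2^N$ whose entries are independent Bernoulli$(0.5)$ random variables; vectors for different slots are independent. In each slot, Bob and Eve successfully receive the packet with probabilities $\mathrm{P}_{\rm B}$ and $\mathrm{P}_{\rm E}$ respectively, independently of each other, across slots, and of the coding vectors. The decoding matrices $\mathbf{B}_t$ (Bob) and $\mathbf{E}_t$ (Eve) are the matrices over $\mathbb{F}_2$ with $N$ columns whose rows are the coding vectors of the packets of the block successfully received in slots $1,\ldots,t$ by the respective receiver. $T$ is the first slot with $\mathrm{rank}(\mathbf{B}_T)=N$. The acknowledgment delay $T_{\rm ack}$ is a nonnegative-integer-valued random variable (in slots), independent of everything else; the block ends at slot $T'=T+T_{\rm ack}$, after which Alice starts the next block, so a block lasts $\tau_q T'$. The block's state vector $\mathbf{s}\in\mathbb{F}_2^N$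 is the indicator vector of the positions of the $D$ dummy packets in the block ($1\le D\le N$), randomly generated with Hamming weight $D$ independently of the coding vectors and receptions. An asynchronization incidence in a block is the event $\mathbf{s}\notin\mathrm{row}(\mathbf{E}_{T'})$, where $\mathrm{row}(\cdot)$ is the row space over $\mathbb{F}_2$; $\mathrm{P}_{\rm asy}=\mathcal{P}(\mathbf{s}\notin\mathrm{row}(\mathbf{E}_{T'}))$. The time to the first incidence is the total duration of all blocks up to and including the first block in which an incidence occurs.
   Formalization: The equality with 1.6 is false (N=1, P_B=1, T_ack=0 gives E[T]=2, not 2.6); it is proved with the exact sum over i=1..N of 1/(2^i-1) in place of 1.6, and 1.6 is shown correct up to max(0.01, (4/3)/2^N). P_asy>0 and finite E[T_ack] are assumed. *)

theory Defs
  imports "HOL-Probability.Probability" "HOL-Library.Z2"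
begin

text \<open>
  A matrix over \<open>\<bbbF>\<^sub>2\<close> with \<open>N = CARD('n)\<close> columns and a random number of rows is the list of its
  rows. Its rank is defined like \<^const>\<open>rank\<close>, which is \<open>vec.dim (rows A)\<close> for matrices whose number
  of rows is fixed by a type.
\<close>

type_synonym 'n row_matrix = "(bit ^ 'n) list"

definition row_space :: "'n::finite row_matrix \<Rightarrow> (bit ^ 'n) set"
  where "row_space A = vec.span (set A)"

definition matrix_rank :: "'n::finite row_matrix \<Rightarrow> nat"
  where "matrix_rank A = vec.dim (set A)"

text \<open>
  The random variables of the model on a sample space \<^typ>\<open>'w\<close>. The first argument is the block.
  The second argument \<open>j\<close> of \<open>coef\<close>, \<open>bob\<close> and \<open>eve\<close> refers to slot \<open>j + 1\<close> of that block, so that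
  the slots \<open>1, \<dots>, t\<close> are the indices below \<open>t\<close>. Every block has an infinite supply of slots, of which
  only those up to its end are used.
\<close>

record ('w, 'n) rlnc =
  coef :: "nat \<Rightarrow> nat \<Rightarrow> 'n \<Rightarrow> 'w \<Rightarrow> bit"
  bob :: "nat \<Rightarrow> nat \<Rightarrow> 'w \<Rightarrow> bool"
  eve :: "nat \<Rightarrow> nat \<Rightarrow> 'w \<Rightarrow> bool"
  ack :: "nat \<Rightarrow> 'w \<Rightarrow> nat"
  dummies :: "nat \<Rightarrow> 'w \<Rightarrow> 'n set"

definition coding_vector :: "('w, 'n::finite) rlnc \<Rightarrow> nat \<Rightarrow> nat \<Rightarrow> 'w \<Rightarrow> bit ^ 'n"
  where "coding_vector R k j w = (\<chi> i. coef R k j i w)"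

definition bob_matrix :: "('w, 'n::finite) rlnc \<Rightarrow> nat \<Rightarrow> nat \<Rightarrow> 'w \<Rightarrow> 'n row_matrix"
  where "bob_matrix R k t w = map (\<lambda>j. coding_vector R k j w) (filter (\<lambda>j. bob R k j w) [0..<t])"

definition eve_matrix :: "('w, 'n::finite) rlnc \<Rightarrow> nat \<Rightarrow> nat \<Rightarrow> 'w \<Rightarrow> 'n row_matrix"
  where "eve_matrix R k t w = map (\<lambda>j. coding_vector R k j w) (filter (\<lambda>j. eve R k j w) [0..<t])"

definition state_vector :: "('w, 'n::finite) rlnc \<Rightarrow> nat \<Rightarrow> 'w \<Rightarrow> bit ^ 'n"
  where "state_vector R k w = (\<chi> i. if i \<in> dummies R k w then 1 else 0)"

text \<open>The slot \<open>T\<close>; meaningful only if Bob ever reaches full rank.\<close>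

definition decoding_slot :: "('w, 'n::finite) rlnc \<Rightarrow> nat \<Rightarrow> 'w \<Rightarrow> nat"
  where "decoding_slot R k w = (LEAST t. matrix_rank (bob_matrix R k t w) = CARD('n))"

definition final_slot :: "('w, 'n::finite) rlnc \<Rightarrow> nat \<Rightarrow> 'w \<Rightarrow> nat"
  where "final_slot R k w = decoding_slot R k w + ack R k w"

definition asynchronized :: "('w, 'n::finite) rlnc \<Rightarrow> nat \<Rightarrow> 'w \<Rightarrow> bool"
  where "asynchronized R k w \<longleftrightarrow>
    state_vector R k w \<notin> row_space (eve_matrix R k (final_slot R k w) w)"

definition asy_prob :: "'w measure \<Rightarrow> ('w, 'n::finite) rlnc \<Rightarrow> nat \<Rightarrow> real"
  where "asy_prob M R k = measure M {w \<in> space M. asynchronized R k w}"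

text \<open>
  Incidences are counted from \<open>0\<close>, and an incidence occurs at the end of its block. The block of
  incidence \<open>m\<close> is meaningful for every \<open>m\<close> only if infinitely many blocks have an incidence.
\<close>

definition incidence_block :: "('w, 'n::finite) rlnc \<Rightarrow> nat \<Rightarrow> 'w \<Rightarrow> nat"
  where "incidence_block R m w = enumerate {k. asynchronized R k w} m"

definition incidence_time :: "real \<Rightarrow> ('w, 'n::finite) rlnc \<Rightarrow> nat \<Rightarrow> 'w \<Rightarrow> real"
  where "incidence_time \<tau>\<^sub>q R m w = (\<Sum>k\<le>incidence_block R m w. \<tau>\<^sub>q * real (final_slot R k w))"

text \<open>All random variables of the model as one family, in order to state their joint independence.\<close>

datatype 'n source = Coef nat nat 'n | Bob nat nat | Eve nat nat | Ack nat | Dummies nat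

datatype 'n outcome = Entry bit | Received bool | Delay nat | Positions "'n set"

fun source_var :: "('w, 'n) rlnc \<Rightarrow> 'n source \<Rightarrow> 'w \<Rightarrow> 'n outcome" where
  "source_var R (Coef k j i) w = Entry (coef R k j i w)"
| "source_var R (Bob k j) w = Received (bob R k j w)"
| "source_var R (Eve k j) w = Received (eve R k j w)"
| "source_var R (Ack k) w = Delay (ack R k w)"
| "source_var R (Dummies k) w = Positions (dummies R k w)"

locale rlnc_model = prob_space M
  for M :: "'w measure" and R :: "('w, 'n::finite) rlnc" and P\<^sub>B P\<^sub>E :: real and D :: nat +
  assumes indep: "indep_vars (\<lambda>_. count_space UNIV) (source_var R) UNIV"
    and coef_prob: "\<And>k j i. prob {w \<in> space M. coef R k j i w = 1} = 1 / 2"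
    and bob_prob: "\<And>k j. prob {w \<in> space M. bob R k j w} = P\<^sub>B"
    and eve_prob: "\<And>k j. prob {w \<in> space M. eve R k j w} = P\<^sub>E"
    and ack_identical: "\<And>k l. distr M (count_space UNIV) (ack R k) = distr M (count_space UNIV) (ack R l)"
    and dummies_identical:
      "\<And>k l. distr M (count_space UNIV) (dummies R k) = distr M (count_space UNIV) (dummies R l)"
    and D_bounds: "1 \<le> D" "D \<le> CARD('n)"
    and dummies_card: "\<And>k. AE w in M. card (dummies R k w) = D"

text \<open>
  If \<open>r < N\<close> is the current rank, a received packet raises it with probability
  \<open>1 - 1 / 2 ^ (N - r)\<close>. Hence full rank takes on average
  \<open>(\<Sum>i = 1..N. 1 / (1 - 1 / 2 ^ i)) = N + (\<Sum>i = 1..N. 1 / (2 ^ i - 1))\<close> received packets. The last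
  sum converges to \<open>1.6067\<dots>\<close> as \<open>N\<close> grows, whence the customary value \<open>1.6\<close>.
\<close>

definition mean_overhead :: "nat \<Rightarrow> real"
  where "mean_overhead N = (\<Sum>i = 1..N. 1 / (2 ^ i - 1))"

end

theory Submission
  imports Defs
begin

text \<open>
  The durations of the blocks between two incidences are summed by Wald's argument. Block \<open>k\<close> belongs
  to the interval \<open>m\<close> exactly if \<open>m\<close> incidences occurred in the blocks before it, an event that is
  independent of the duration of block \<open>k\<close>. If \<open>\<mu>\<close> is the mean number of slots per block and \<open>p\<close> the
  probability of an incidence, then the mean number of slots in interval \<open>m\<close> is \<open>\<mu>\<close> times the mean
  number of blocks that start after exactly \<open>m\<close> incidences. This number is \<open>1 / p\<close> for every \<open>m\<close>, whence
  the time to the first incidence and the time between consecutive ones have the same mean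
  (\<open>renewal_reward\<close>). Within one block, the duration and the incidence may be dependent.

  For \<open>\<mu>\<close>, the rank of Bob's matrix grows from \<open>r\<close> to \<open>r + 1\<close> with probability
  \<open>P\<^sub>B * (1 - 2 ^ r / 2 ^ N)\<close> in each slot (\<open>rank_raise\<close>), because a subspace of
  dimension \<open>r\<close> has \<open>2 ^ r\<close> elements and the coding vector is uniform and independent of the past. The
  mean waiting times add up to \<open>(N + mean_overhead N) / P\<^sub>B\<close>, to which the mean acknowledgment
  delay is added.

  The two parts share one lemma on pure birth chains (\<open>birth_sojourn_prob_sums\<close>): a
  state that is left with probability \<open>c\<close> per step is occupied for \<open>1 / c\<close> steps on average. One
  chain is the rank, over the slots of a block; the other is the number of incidences, over the blocks.

  That blocks are independent and have the same incidence probability is derived from the joint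
  independence of the elementary sources. A block is written as a function of its sources on
  the canonical sample space (\<open>path_model\<close>), and the sources of two blocks have the same product law
  (\<open>block_path_law\<close>).
\<close>

section \<open>Sojourn times of a pure birth chain\<close>

text \<open>
  Conservation of mass at one state of a chain: what has flowed in minus what is still there equals
  what has flowed out, and the outflow is \<open>c\<close> times the time spent in the state. If mass \<open>1\<close> flows in
  eventually, the accumulated time \<open>\<Sum>t<n. v t\<close> stays below \<open>1 / c\<close>; hence \<open>v\<close> vanishes in the limit
  and the bound is attained.
\<close>

lemma birth_flow_sums:
  fixes v :: "nat \<Rightarrow> real"
  assumes nonneg: "\<And>t. 0 \<le> v t" and "0 < c"
    and balance: "\<And>n. c * (\<Sum>t<n. v t) = inflow n - v n"
    and bounded: "\<And>n. inflow n \<le> 1" and limit: "inflow \<longlonglongrightarrow> 1"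
  shows "v sums (1 / c)"
proof -
  have "(\<Sum>t<n. v t) \<le> 1 / c" for n
    using balance[of n] nonneg[of n] bounded[of n] \<open>0 < c\<close> by (simp add: field_simps)
  then have "summable v"
    by (intro summableI_nonneg_bounded nonneg)
  then have "(\<lambda>n. (inflow n - v n) / c) \<longlonglongrightarrow> (1 - 0) / c"
    by (intro tendsto_intros limit summable_LIMSEQ_zero) (use \<open>0 < c\<close> in auto)
  moreover have "(inflow n - v n) / c = (\<Sum>t<n. v t)" for n
    using balance[of n] \<open>0 < c\<close> by (simp add: field_simps)
  ultimately show ?thesis
    by (simp add: sums_def)
qed

text \<open>
  Here \<open>u t r\<close> is the probability of being in state \<open>r\<close> at time \<open>t\<close>, and \<open>c r\<close> is the probability of
  leaving \<open>r\<close> for \<open>Suc r\<close> in one step. The outflow of state \<open>r\<close> is the inflow of state \<open>Suc r\<close>, so that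
  unit mass passes through every state \<open>r < n\<close> in turn. The hypotheses
  stop below state \<open>n\<close> because the rank of a matrix is absorbed at its maximum.
\<close>

lemma birth_sojourn_sums:
  fixes u :: "nat \<Rightarrow> nat \<Rightarrow> real"
  assumes nonneg: "\<And>t r. 0 \<le> u t r"
    and start: "\<And>r. u 0 r = (if r = 0 then 1 else 0)"
    and stay: "\<And>t. u (Suc t) 0 = (1 - c 0) * u t 0"
    and move: "\<And>t r. Suc r < n \<Longrightarrow> u (Suc t) (Suc r) = (1 - c (Suc r)) * u t (Suc r) + c r * u t r"
    and pos: "\<And>r. r < n \<Longrightarrow> 0 < c r"
  shows "r < n \<Longrightarrow> (\<lambda>t. u t r) sums (1 / c r)"
proof (induction r)
  case 0
  have "c 0 * (\<Sum>t<n. u t 0) = 1 - u n 0" for n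
    by (induction n) (simp_all add: start stay algebra_simps)
  then show ?case
    using 0 by (intro birth_flow_sums[where inflow = "\<lambda>_. 1"] nonneg pos) auto
next
  case (Suc r)
  then have IH: "(\<lambda>t. u t r) sums (1 / c r)" and "0 < c r"
    using pos by auto
  have "c (Suc r) * (\<Sum>t<n. u t (Suc r)) = c r * (\<Sum>t<n. u t r) - u n (Suc r)" for n
    by (induction n) (simp_all add: start move[OF \<open>Suc r < _\<close>] algebra_simps)
  moreover have "c r * (\<Sum>t<n. u t r) \<le> 1" for n
    using sum_le_suminf[OF sums_summable[OF IH], of "{..<n}"] nonneg \<open>0 < c r\<close>
    by (simp add: sums_unique[OF IH, symmetric] pos_le_divide_eq mult.commute)
  moreover have "(\<lambda>n. c r * (\<Sum>t<n. u t r)) \<longlonglongrightarrow> c r * (1 / c r)"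
    using IH unfolding sums_def by (intro tendsto_intros)
  ultimately show ?case
    using Suc.prems \<open>0 < c r\<close>
    by (intro birth_flow_sums[where inflow = "\<lambda>n. c r * (\<Sum>t<n. u t r)"] nonneg pos) auto
qed

text \<open>
  The expected time spent in a state that is left with probability \<open>c r\<close> is \<open>1 / c r\<close>. The one-step
  law is demanded only on average over the past, not conditionally on it. The lemma applies to the
  rank of Bob's matrix and to the number of past incidences.
\<close>

lemma (in prob_space) birth_sojourn_prob_sums:
  fixes S :: "nat \<Rightarrow> 'a \<Rightarrow> nat"
  assumes S [measurable]: "\<And>t. S t \<in> measurable M (count_space UNIV)"
    and start: "\<And>w. S 0 w = 0"
    and step: "\<And>t w. S (Suc t) w = S t w \<or> S (Suc t) w = Suc (S t w)"
    and up: "\<And>t r. r < n \<Longrightarrow>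
      prob {w \<in> space M. S t w = r \<and> S (Suc t) w = Suc r} = c r * prob {w \<in> space M. S t w = r}"
    and pos: "\<And>r. r < n \<Longrightarrow> 0 < c r"
    and "r < n"
  shows "(\<lambda>t. prob {w \<in> space M. S t w = r}) sums (1 / c r)"
proof -
  define u where "u t r = prob {w \<in> space M. S t w = r}" for t r
  define out where "out t r = prob {w \<in> space M. S t w = r \<and> S (Suc t) w = Suc r}" for t r
  have out: "out t r = c r * u t r" if "r < n" for t r
    using up[OF that] by (simp add: out_def u_def)
  have rest: "prob {w \<in> space M. S t w = r \<and> S (Suc t) w = r} = u t r - out t r" for t r
  proof -
    have "{w \<in> space M. S t w = r \<and> S (Suc t) w = r}
        = {w \<in> space M. S t w = r} - {w \<in> space M. S t w = r \<and> S (Suc t) w = Suc r}"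
      using step[of t] by force
    then show ?thesis
      by (simp add: u_def out_def) (subst finite_measure_Diff; auto)
  qed
  have "u (Suc t) 0 = (1 - c 0) * u t 0" for t
  proof -
    have "u (Suc t) 0 = prob {w \<in> space M. S t w = 0 \<and> S (Suc t) w = 0}"
      unfolding u_def by (rule arg_cong[where f = prob]) (use step[of t] in \<open>metis nat.distinct(1)\<close>)
    then show ?thesis
      using rest[of t 0] out[of 0 t] \<open>r < n\<close> by (simp add: algebra_simps)
  qed
  moreover have "u (Suc t) (Suc r) = (1 - c (Suc r)) * u t (Suc r) + c r * u t r"
    if "Suc r < n" for t r
  proof -
    have "{w \<in> space M. S (Suc t) w = Suc r}
      = {w \<in> space M. S t w = Suc r \<and> S (Suc t) w = Suc r} \<union> {w \<in> space M. S t w = r \<and> S (Suc t) w = Suc r}"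
      using step[of t] by (auto dest: Suc_inject) (metis Suc_inject)+
    then have "u (Suc t) (Suc r) = prob {w \<in> space M. S t w = Suc r \<and> S (Suc t) w = Suc r} + out t r"
      unfolding u_def out_def by (simp, intro finite_measure_Union) auto
    then show ?thesis
      using rest[of t "Suc r"] out[of r t] out[of "Suc r" t] that by (simp add: algebra_simps)
  qed
  moreover have "u 0 r = (if r = 0 then 1 else 0)" for r
    by (simp add: u_def start prob_space)
  ultimately show ?thesis
    using birth_sojourn_sums[of u c n r] pos \<open>r < n\<close> by (simp add: u_def)
qed

section \<open>Independence of discrete random variables\<close>

text \<open>
  \<^const>\<open>prob_space.indep_var\<close> is an instance of independence of a family and therefore forces
  both variables into one type. The variables compared here have different types.
\<close>

definition (in prob_space) indep_pair :: "('a \<Rightarrow> 'b) \<Rightarrow> ('a \<Rightarrow> 'c) \<Rightarrow> bool"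
  where "indep_pair X Y \<longleftrightarrow>
    X \<in> measurable M (count_space UNIV) \<and> Y \<in> measurable M (count_space UNIV) \<and>
    (\<forall>S T. prob {w \<in> space M. X w \<in> S \<and> Y w \<in> T}
      = prob {w \<in> space M. X w \<in> S} * prob {w \<in> space M. Y w \<in> T})"

lemma (in prob_space) indep_pair_restrict:
  assumes "indep_vars M' X I" "A \<inter> B = {}" "A \<subseteq> I" "B \<subseteq> I"
    and f: "f \<in> measurable (PiM A M') (count_space UNIV)"
    and g: "g \<in> measurable (PiM B M') (count_space UNIV)"
  shows "indep_pair (\<lambda>w. f (\<lambda>i\<in>A. X i w)) (\<lambda>w. g (\<lambda>i\<in>B. X i w))"
proof -
  have indep: "indep_var (PiM A M') (\<lambda>w. \<lambda>i\<in>A. X i w) (PiM B M') (\<lambda>w. \<lambda>i\<in>B. X i w)"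
    by (rule indep_var_restrict) fact+
  then have A: "(\<lambda>w. \<lambda>i\<in>A. X i w) \<in> measurable M (PiM A M')"
    and B: "(\<lambda>w. \<lambda>i\<in>B. X i w) \<in> measurable M (PiM B M')"
    by (simp_all add: indep_var_eq)
  have "prob {w \<in> space M. f (\<lambda>i\<in>A. X i w) \<in> S \<and> g (\<lambda>i\<in>B. X i w) \<in> T}
      = prob {w \<in> space M. f (\<lambda>i\<in>A. X i w) \<in> S} * prob {w \<in> space M. g (\<lambda>i\<in>B. X i w) \<in> T}" for S T
  proof -
    let ?S = "f -` S \<inter> space (PiM A M')" and ?T = "g -` T \<inter> space (PiM B M')"
    have "{w \<in> space M. f (\<lambda>i\<in>A. X i w) \<in> S \<and> g (\<lambda>i\<in>B. X i w) \<in> T}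
        = (\<lambda>w. (\<lambda>i\<in>A. X i w, \<lambda>i\<in>B. X i w)) -` (?S \<times> ?T) \<inter> space M"
      "{w \<in> space M. f (\<lambda>i\<in>A. X i w) \<in> S} = (\<lambda>w. \<lambda>i\<in>A. X i w) -` ?S \<inter> space M"
      "{w \<in> space M. g (\<lambda>i\<in>B. X i w) \<in> T} = (\<lambda>w. \<lambda>i\<in>B. X i w) -` ?T \<inter> space M"
      using measurable_space[OF A] measurable_space[OF B] by auto
    then show ?thesis
      using indep_varD[OF indep, of ?S ?T] f g by (simp add: measurable_sets)
  qed
  then show ?thesis
    using measurable_compose[OF A f] measurable_compose[OF B g] by (simp add: indep_pair_def)
qed

text \<open>
  If the conditional probability of \<open>Y \<in> G x\<close> is the same number for all values \<open>x \<in> S\<close> of an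
  independent \<open>X\<close>, then it can be taken out although the target set \<open>G X\<close> is random. For Bob, \<open>X\<close> is
  the row space, and the number depends on its dimension only.
\<close>

lemma (in prob_space) indep_pair_conditional:
  assumes indep: "indep_pair X Y"
    and "finite S" and cond: "\<And>x. x \<in> S \<Longrightarrow> prob {w \<in> space M. Y w \<in> G x} = c"
  shows "prob {w \<in> space M. X w \<in> S \<and> Y w \<in> G (X w)} = c * prob {w \<in> space M. X w \<in> S}"
proof -
  have X: "X \<in> measurable M (count_space UNIV)" and Y: "Y \<in> measurable M (count_space UNIV)"
    using indep by (simp_all add: indep_pair_def)
  have events: "{w \<in> space M. X w = x \<and> Y w \<in> H x} \<in> events" for x H
  proof -
    have "{w \<in> space M. X w = x \<and> Y w \<in> H x} = (X -` {x} \<inter> space M) \<inter> (Y -` H x \<inter> space M)"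
      by auto
    then show ?thesis
      using measurable_sets[OF X, of "{x}"] measurable_sets[OF Y, of "H x"] by auto
  qed
  have split: "prob {w \<in> space M. X w \<in> S \<and> Y w \<in> H (X w)}
      = (\<Sum>x\<in>S. prob {w \<in> space M. X w \<in> {x} \<and> Y w \<in> H x})" for H
  proof -
    have "{w \<in> space M. X w \<in> S \<and> Y w \<in> H (X w)}
        = (\<Union>x\<in>S. {w \<in> space M. X w \<in> {x} \<and> Y w \<in> H x})"
      by auto
    then show ?thesis
      using \<open>finite S\<close>
      by (simp only:, intro finite_measure_finite_Union image_subsetI) (auto simp: disjoint_family_on_def events)
  qed
  have "prob {w \<in> space M. X w \<in> S \<and> Y w \<in> G (X w)} = (\<Sum>x\<in>S. prob {w \<in> space M. X w \<in> {x}} * c)"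
    using indep by (simp only: indep_pair_def split cond cong: sum.cong)
  moreover have "prob {w \<in> space M. X w \<in> S} = (\<Sum>x\<in>S. prob {w \<in> space M. X w \<in> {x}})"
    using split[of "\<lambda>_. UNIV"] by simp
  ultimately show ?thesis
    by (simp add: sum_distrib_left mult.commute)
qed

section \<open>Linear algebra over the field of two elements\<close>

lemma UNIV_bit: "(UNIV :: bit set) = {0, 1}"
  using bit.exhaust by auto

instance bit :: finite
  by standard (metis UNIV_bit finite.emptyI finite.insertI)

lemma card_UNIV_bit: "CARD(bit) = 2"
  by (metis UNIV_bit card_2_iff zero_neq_one)

text \<open>
  A vector outside the span doubles it: the only nonzero scalar is \<open>1\<close>, so the new span consists of the
  old one and one disjoint translate.
\<close>

lemma card_span_bit:
  fixes B :: "(bit ^ 'n::finite) set"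
  assumes "vec.independent B"
  shows "card (vec.span B) = 2 ^ card B"
proof -
  have "finite B" by simp
  then show ?thesis
    using assms
  proof (induction B rule: finite_induct)
    case empty
    then show ?case by simp
  next
    case (insert a B)
    have a: "a \<notin> vec.span B" and B: "vec.independent B"
      using insert by (auto simp: vec.independent_insert)
    have bits: "k = 0 \<or> k = 1" for k :: bit
      by (cases k) auto
    have "vec.span (insert a B) = vec.span B \<union> (+) a ` vec.span B"
    proof -
      have "x \<in> vec.span (insert a B) \<longleftrightarrow> x \<in> vec.span B \<or> x - a \<in> vec.span B" for x
      proof -
        have "(\<exists>k. x - k *s a \<in> vec.span B) \<longleftrightarrow> x - 0 *s a \<in> vec.span B \<or> x - 1 *s a \<in> vec.span B"
          using bits by metis
        then show ?thesis
          unfolding vec.span_insert by simp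
      qed
      moreover have "x \<in> (+) a ` vec.span B \<longleftrightarrow> x - a \<in> vec.span B" for x
        by (auto simp: image_iff intro: bexI[of _ "x - a"])
      ultimately show ?thesis
        by blast
    qed
    moreover have "vec.span B \<inter> (+) a ` vec.span B = {}"
    proof (intro equals0I)
      fix x assume "x \<in> vec.span B \<inter> (+) a ` vec.span B"
      then obtain y where "a + y \<in> vec.span B" "y \<in> vec.span B"
        by auto
      then have "(a + y) - y \<in> vec.span B"
        by (rule vec.span_diff)
      then show False
        using a by simp
    qed
    moreover have "card ((+) a ` vec.span B) = card (vec.span B)"
      by (intro card_image) simp
    ultimately show ?case
      using insert B by (simp add: card_Un_disjoint)
  qed
qed

lemma card_subspace_bit:
  fixes W :: "(bit ^ 'n::finite) set"
  assumes "vec.subspace W"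
  shows "card W = 2 ^ vec.dim W"
proof -
  obtain B where "B \<subseteq> W" "vec.independent B" "W \<subseteq> vec.span B" "card B = vec.dim W"
    using vec.basis_exists by metis
  then show ?thesis
    using card_span_bit[of B] vec.span_minimal[of B W] assms by auto
qed

lemma bob_matrix_Suc:
  "bob_matrix R k (Suc t) w
    = bob_matrix R k t w @ (if bob R k t w then [coding_vector R k t w] else [])"
  by (simp add: bob_matrix_def)

lemma matrix_rank_Nil: "matrix_rank [] = 0"
  by (simp add: matrix_rank_def)

lemma matrix_rank_row_space: "matrix_rank A = vec.dim (row_space A)"
  unfolding matrix_rank_def row_space_def by (rule vec.dim_span[symmetric])

lemma matrix_rank_snoc:
  "matrix_rank (A @ [v]) = (if v \<in> row_space A then matrix_rank A else Suc (matrix_rank A))"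
proof -
  have "set (A @ [v]) = insert v (set A)"
    by simp
  then show ?thesis
    unfolding matrix_rank_def row_space_def using vec.dim_insert[of v "set A"] by (metis Suc_eq_plus1)
qed

lemma matrix_rank_le: "matrix_rank (A :: 'n::finite row_matrix) \<le> CARD('n)"
  unfolding matrix_rank_def by (rule dim_subset_UNIV_cart_gen)

section \<open>The block as a function of its sources\<close>

text \<open>
  Both independence and equality in law are known for the elementary sources only. To transport them
  to the matrices and to the end of a block, each of these is expressed as a function of the sources
  on which it depends, and this function is shown to be measurable.
\<close>

definition bob_sources :: "nat \<Rightarrow> nat \<Rightarrow> 'n source set"
  where "bob_sources k t = {Bob k j |j. j < t} \<union> {Coef k j i |j i. j < t}"

definition slot_sources :: "nat \<Rightarrow> nat \<Rightarrow> 'n source set"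
  where "slot_sources k t = insert (Bob k t) (range (Coef k t))"

fun shift_block :: "nat \<Rightarrow> 'n source \<Rightarrow> 'n source" where
  "shift_block k (Coef _ j i) = Coef k j i"
| "shift_block k (Bob _ j) = Bob k j"
| "shift_block k (Eve _ j) = Eve k j"
| "shift_block k (Ack _) = Ack k"
| "shift_block k (Dummies _) = Dummies k"

definition block_sources :: "nat \<Rightarrow> 'n source set"
  where "block_sources k = range (shift_block k)"

lemma block_sources_simps [simp]:
  "Coef l j i \<in> block_sources k \<longleftrightarrow> l = k" "Bob l j \<in> block_sources k \<longleftrightarrow> l = k"
  "Eve l j \<in> block_sources k \<longleftrightarrow> l = k" "Ack l \<in> block_sources k \<longleftrightarrow> l = k"
  "Dummies l \<in> block_sources k \<longleftrightarrow> l = k"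
proof -
  have mem: "s \<in> block_sources k \<longleftrightarrow> s = shift_block k s" for s :: "'n source"
  proof
    assume "s \<in> block_sources k"
    then obtain s' where "s = shift_block k s'"
      by (auto simp: block_sources_def)
    then show "s = shift_block k s"
      by (cases s') auto
  qed (auto simp: block_sources_def)
  show "Coef l j i \<in> block_sources k \<longleftrightarrow> l = k" "Bob l j \<in> block_sources k \<longleftrightarrow> l = k"
    "Eve l j \<in> block_sources k \<longleftrightarrow> l = k" "Ack l \<in> block_sources k \<longleftrightarrow> l = k"
    "Dummies l \<in> block_sources k \<longleftrightarrow> l = k"
    unfolding mem by simp_all
qed

lemma disjoint_block_sources: "k \<noteq> l \<Longrightarrow> block_sources k \<inter> block_sources l = {}"
proof (intro equals0I)
  fix s :: "'n source"
  assume "k \<noteq> l" "s \<in> block_sources k \<inter> block_sources l"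
  then show False
    by (cases s) auto
qed

lemma bob_sources_subset: "bob_sources k t \<subseteq> block_sources k"
  by (auto simp: bob_sources_def)

text \<open>
  The model on the canonical sample space, where a sample point is the family of values of all sources. The
  functions of Bob, Eve and the block, evaluated in this model, are the functions through which the
  corresponding random variables of an arbitrary model factor. An ill-typed value of a source is
  replaced by a default.
\<close>

definition path_model :: "('n source \<Rightarrow> 'n outcome, 'n) rlnc" where
  "path_model = \<lparr>
    coef = (\<lambda>k j i \<omega>. case \<omega> (Coef k j i) of Entry c \<Rightarrow> c | _ \<Rightarrow> 0),
    bob = (\<lambda>k j \<omega>. case \<omega> (Bob k j) of Received c \<Rightarrow> c | _ \<Rightarrow> False),
    eve = (\<lambda>k j \<omega>. case \<omega> (Eve k j) of Received c \<Rightarrow> c | _ \<Rightarrow> False),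
    ack = (\<lambda>k \<omega>. case \<omega> (Ack k) of Delay d \<Rightarrow> d | _ \<Rightarrow> 0),
    dummies = (\<lambda>k \<omega>. case \<omega> (Dummies k) of Positions S \<Rightarrow> S | _ \<Rightarrow> {})\<rparr>"

lemma measurable_source_path_model:
  assumes "s \<in> K"
  shows "source_var path_model s \<in> measurable (PiM K (\<lambda>_. count_space UNIV)) (count_space UNIV)"
proof -
  have comp: "(\<lambda>\<omega>. g (\<omega> s)) \<in> measurable (PiM K (\<lambda>_. count_space UNIV)) (count_space UNIV)"
    for g :: "'n outcome \<Rightarrow> 'n outcome"
    by (rule measurable_compose[OF measurable_component_singleton[OF assms]]) simp
  show ?thesis
  proof (cases s)
    case (Coef k j i)
    then show ?thesis
      using comp[of "\<lambda>x. Entry (case x of Entry c \<Rightarrow> c | _ \<Rightarrow> 0)"] by (simp add: path_model_def cong: measurable_cong_simp)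
  next
    case (Bob k j)
    then show ?thesis
      using comp[of "\<lambda>x. Received (case x of Received c \<Rightarrow> c | _ \<Rightarrow> False)"] by (simp add: path_model_def cong: measurable_cong_simp)
  next
    case (Eve k j)
    then show ?thesis
      using comp[of "\<lambda>x. Received (case x of Received c \<Rightarrow> c | _ \<Rightarrow> False)"] by (simp add: path_model_def cong: measurable_cong_simp)
  next
    case (Ack k)
    then show ?thesis
      using comp[of "\<lambda>x. Delay (case x of Delay c \<Rightarrow> c | _ \<Rightarrow> 0)"] by (simp add: path_model_def cong: measurable_cong_simp)
  next
    case (Dummies k)
    then show ?thesis
      using comp[of "\<lambda>x. Positions (case x of Positions c \<Rightarrow> c | _ \<Rightarrow> {})"] by (simp add: path_model_def cong: measurable_cong_simp)
  qed
qed

lemma measurable_of_source_var: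
  fixes R :: "('w, 'n::finite) rlnc"
  shows "source_var R (Coef k j i) \<in> measurable M (count_space UNIV) \<Longrightarrow> coef R k j i \<in> measurable M (count_space UNIV)"
    "source_var R (Bob k j) \<in> measurable M (count_space UNIV) \<Longrightarrow> bob R k j \<in> measurable M (count_space UNIV)"
    "source_var R (Eve k j) \<in> measurable M (count_space UNIV) \<Longrightarrow> eve R k j \<in> measurable M (count_space UNIV)"
    "source_var R (Ack k) \<in> measurable M (count_space UNIV) \<Longrightarrow> ack R k \<in> measurable M (count_space UNIV)"
    "source_var R (Dummies k) \<in> measurable M (count_space UNIV) \<Longrightarrow> dummies R k \<in> measurable M (count_space UNIV)"
proof -
  have comp: "(\<lambda>w. f (source_var R s w)) \<in> measurable M (count_space UNIV)"
    if "source_var R s \<in> measurable M (count_space UNIV)"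
    for s and f :: "'n outcome \<Rightarrow> 'b"
    using that by (rule measurable_compose) simp
  show "coef R k j i \<in> measurable M (count_space UNIV)"
    if "source_var R (Coef k j i) \<in> measurable M (count_space UNIV)"
    using comp[OF that, of "\<lambda>x. case x of Entry c \<Rightarrow> c"] by simp
  show "bob R k j \<in> measurable M (count_space UNIV)"
    if "source_var R (Bob k j) \<in> measurable M (count_space UNIV)"
    using comp[OF that, of "\<lambda>x. case x of Received c \<Rightarrow> c"] by simp
  show "eve R k j \<in> measurable M (count_space UNIV)"
    if "source_var R (Eve k j) \<in> measurable M (count_space UNIV)"
    using comp[OF that, of "\<lambda>x. case x of Received c \<Rightarrow> c"] by simp
  show "ack R k \<in> measurable M (count_space UNIV)"
    if "source_var R (Ack k) \<in> measurable M (count_space UNIV)"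
    using comp[OF that, of "\<lambda>x. case x of Delay c \<Rightarrow> c"] by simp
  show "dummies R k \<in> measurable M (count_space UNIV)"
    if "source_var R (Dummies k) \<in> measurable M (count_space UNIV)"
    using comp[OF that, of "\<lambda>x. case x of Positions c \<Rightarrow> c"] by simp
qed

lemma measurable_count_space_binary:
  fixes X :: "'w \<Rightarrow> 'a::countable" and Y :: "'w \<Rightarrow> 'b"
  assumes X: "X \<in> measurable M (count_space UNIV)" and Y: "Y \<in> measurable M (count_space UNIV)"
  shows "(\<lambda>w. h (X w) (Y w)) \<in> measurable M (count_space UNIV)"
  by (rule measurable_compose_countable[OF measurable_compose[OF Y] X]) simp

lemma measurable_coding_vector:
  fixes R :: "('w, 'n::finite) rlnc"
  assumes [measurable]: "\<And>i. coef R k j i \<in> measurable M (count_space UNIV)"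
  shows "coding_vector R k j \<in> measurable M (count_space UNIV)"
  unfolding measurable_count_space_eq2_countable
proof safe
  show "coding_vector R k j -` {v} \<inter> space M \<in> sets M" for v
  proof -
    have "coding_vector R k j -` {v} \<inter> space M = {w \<in> space M. \<forall>i. coef R k j i w = v $ i}"
      by (auto simp: coding_vector_def vec_eq_iff)
    then show ?thesis by simp
  qed
qed simp_all

lemma measurable_received_rows:
  fixes g :: "nat \<Rightarrow> 'w \<Rightarrow> bool" and v :: "nat \<Rightarrow> 'w \<Rightarrow> 'a::countable"
  assumes "\<And>j. j < t \<Longrightarrow> g j \<in> measurable M (count_space UNIV)"
    and "\<And>j. j < t \<Longrightarrow> v j \<in> measurable M (count_space UNIV)"
  shows "(\<lambda>w. map (\<lambda>j. v j w) (filter (\<lambda>j. g j w) [0..<t])) \<in> measurable M (count_space UNIV)"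
  using assms
proof (induction t)
  case (Suc t)
  have "(\<lambda>w. if g t w then [v t w] else []) \<in> measurable M (count_space UNIV)"
    using measurable_count_space_binary[of "g t" M "v t" "\<lambda>b x. if b then [x] else []"] Suc.prems by simp
  then have "(\<lambda>w. map (\<lambda>j. v j w) (filter (\<lambda>j. g j w) [0..<t]) @ (if g t w then [v t w] else []))
      \<in> measurable M (count_space UNIV)"
    using Suc by (intro measurable_count_space_binary[where h = "(@)"]) auto
  moreover have "map (\<lambda>j. v j w) (filter (\<lambda>j. g j w) [0..<Suc t])
      = map (\<lambda>j. v j w) (filter (\<lambda>j. g j w) [0..<t]) @ (if g t w then [v t w] else [])" for w
    by simp
  ultimately show ?case
    by presburger
qed simp

lemma measurable_bob_matrix:
  fixes R :: "('w, 'n::finite) rlnc"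
  assumes "\<And>s. s \<in> bob_sources k t \<Longrightarrow> source_var R s \<in> measurable M (count_space UNIV)"
  shows "bob_matrix R k t \<in> measurable M (count_space UNIV)"
  unfolding bob_matrix_def[abs_def]
  by (intro measurable_received_rows measurable_coding_vector measurable_of_source_var assms)
    (auto simp: bob_sources_def)

text \<open>
  The slot \<open>T'\<close> is random, and Eve's matrix is needed at that slot. As \<open>T'\<close> has countably many values,
  it suffices that her matrix is measurable at every fixed slot.
\<close>

lemma measurable_block:
  fixes R :: "('w, 'n::finite) rlnc"
  assumes src: "\<And>s. s \<in> block_sources k \<Longrightarrow> source_var R s \<in> measurable M (count_space UNIV)"
  shows measurable_decoding_slot: "decoding_slot R k \<in> measurable M (count_space UNIV)"
    and measurable_final_slot: "final_slot R k \<in> measurable M (count_space UNIV)"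
    and measurable_asynchronized: "asynchronized R k \<in> measurable M (count_space UNIV)"
proof -
  have "bob_matrix R k t \<in> measurable M (count_space UNIV)" for t
    using bob_sources_subset by (intro measurable_bob_matrix src) blast
  from measurable_compose[OF this, of "\<lambda>A. matrix_rank A = CARD('n)" "count_space UNIV"]
  have [measurable]: "Measurable.pred M (\<lambda>w. matrix_rank (bob_matrix R k t w) = CARD('n))" for t
    by simp
  show dec: "decoding_slot R k \<in> measurable M (count_space UNIV)"
    unfolding decoding_slot_def[abs_def] by measurable
  have [measurable]: "ack R k \<in> measurable M (count_space UNIV)"
    by (intro measurable_of_source_var src) simp
  show fin: "final_slot R k \<in> measurable M (count_space UNIV)"
    unfolding final_slot_def[abs_def]
    by (rule measurable_count_space_binary[OF dec, where h = "(+)"]) measurable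
  have dummies: "dummies R k \<in> measurable M (count_space UNIV)"
    by (intro measurable_of_source_var src) simp
  have eve: "eve_matrix R k t \<in> measurable M (count_space UNIV)" for t
    unfolding eve_matrix_def[abs_def]
    by (intro measurable_received_rows measurable_coding_vector measurable_of_source_var src) auto
  have "(\<lambda>w. state_vector R k w \<notin> row_space (eve_matrix R k t w)) \<in> measurable M (count_space UNIV)" for t
    using measurable_count_space_binary[OF eve dummies,
        where h = "\<lambda>A S. (\<chi> i. if i \<in> S then 1 else 0) \<notin> row_space A"]
    unfolding state_vector_def .
  from measurable_compose_countable[OF this fin]
  show "asynchronized R k \<in> measurable M (count_space UNIV)"
    unfolding asynchronized_def[abs_def] .
qed

lemma bob_matrix_cong:
  assumes "\<And>j. j < t \<Longrightarrow> bob R k j w = bob R' l j w'" "\<And>j i. j < t \<Longrightarrow> coef R k j i w = coef R' l j i w'"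
  shows "bob_matrix R k t w = bob_matrix R' l t w'"
proof -
  have "filter (\<lambda>j. bob R k j w) [0..<t] = filter (\<lambda>j. bob R' l j w') [0..<t]"
    by (rule filter_cong) (simp_all add: assms)
  then show ?thesis
    by (simp add: bob_matrix_def coding_vector_def assms)
qed

text \<open>
  Bob's matrix after \<open>t\<close> slots does not see the sources of later slots: the values outside \<open>K\<close> may be
  discarded.
\<close>

lemma bob_matrix_path_model:
  assumes "bob_sources k t \<subseteq> K"
  shows "bob_matrix R k t w = bob_matrix path_model k t (restrict (\<lambda>s. source_var R s w) K)"
proof (rule bob_matrix_cong)
  fix j i assume "j < t"
  then have "Bob k j \<in> K" "Coef k j i \<in> K"
    using assms by (auto simp: bob_sources_def)
  then show "bob R k j w = bob path_model k j (restrict (\<lambda>s. source_var R s w) K)"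
    "coef R k j i w = coef path_model k j i (restrict (\<lambda>s. source_var R s w) K)"
    by (simp_all add: path_model_def)
qed

text \<open>
  A block is determined by the values of its own sources. The block numbers and sample spaces may
  differ, so that this covers the passage to the canonical space as well as the shift of a block.
\<close>

lemma block_cong:
  fixes R :: "('w, 'n::finite) rlnc" and R' :: "('v, 'n) rlnc"
  assumes "\<And>j i. coef R k j i w = coef R' l j i w'" "\<And>j. bob R k j w = bob R' l j w'"
    "\<And>j. eve R k j w = eve R' l j w'" "ack R k w = ack R' l w'" "dummies R k w = dummies R' l w'"
  shows "final_slot R k w = final_slot R' l w' \<and> asynchronized R k w = asynchronized R' l w'"
  by (simp add: asynchronized_def final_slot_def decoding_slot_def bob_matrix_def eve_matrix_def
      state_vector_def coding_vector_def assms)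

section \<open>The decoding slot\<close>

context rlnc_model
begin

lemma measurable_source_var [measurable]: "source_var R s \<in> measurable M (count_space UNIV)"
  using indep by (simp add: indep_vars_def)

lemma coef_prob_bit: "prob {w \<in> space M. coef R k j i w = c} = 1 / 2"
proof (cases "c = 0")
  case True
  have [measurable]: "coef R k j i \<in> measurable M (count_space UNIV)"
    by (intro measurable_of_source_var measurable_source_var)
  have "{w \<in> space M. coef R k j i w = 0} = space M - {w \<in> space M. coef R k j i w = 1}"
    by auto
  then show ?thesis
    using True coef_prob[of k j i] by (simp add: prob_compl)
next
  case False
  then show ?thesis
    by (simp add: coef_prob)
qed

text \<open>
  Given reception, the coding vector is uniform, since its entries are fair independent bits.
\<close>

lemma slot_law:
  "prob {w \<in> space M. bob R k t w \<and> coding_vector R k t w = v} = P\<^sub>B / 2 ^ CARD('n)"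
proof -
  \<comment> \<open>The joint event prescribes a value to each source of the slot.\<close>
  define value_of :: "'n source \<Rightarrow> 'n outcome set"
    where "value_of s = (case s of Bob _ _ \<Rightarrow> {Received True} | Coef _ _ i \<Rightarrow> {Entry (v $ i)} | _ \<Rightarrow> UNIV)" for s
  have inj: "inj (Coef k t :: 'n \<Rightarrow> 'n source)"
    by (auto intro: injI)
  have "{w \<in> space M. bob R k t w \<and> coding_vector R k t w = v}
      = (\<Inter>s\<in>slot_sources k t. source_var R s -` value_of s \<inter> space M)"
    by (auto simp: slot_sources_def value_of_def coding_vector_def vec_eq_iff)
  then have "prob {w \<in> space M. bob R k t w \<and> coding_vector R k t w = v}
      = (\<Prod>s\<in>slot_sources k t. prob (source_var R s -` value_of s \<inter> space M))"
    using indep_varsD[OF indep, of "slot_sources k t" value_of] by (simp add: slot_sources_def)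
  also have "\<dots> = prob (source_var R (Bob k t) -` value_of (Bob k t) \<inter> space M)
      * (\<Prod>i\<in>UNIV. prob (source_var R (Coef k t i) -` value_of (Coef k t i) \<inter> space M))"
    unfolding slot_sources_def by (subst prod.insert) (auto simp: prod.reindex[OF inj])
  also have "source_var R (Bob k t) -` value_of (Bob k t) \<inter> space M = {w \<in> space M. bob R k t w}"
    by (auto simp: value_of_def)
  also have "(\<Prod>i\<in>UNIV. prob (source_var R (Coef k t i) -` value_of (Coef k t i) \<inter> space M))
      = (\<Prod>i\<in>(UNIV :: 'n set). 1 / 2)"
  proof (rule prod.cong[OF refl])
    fix i :: 'n
    have "source_var R (Coef k t i) -` value_of (Coef k t i) \<inter> space M
        = {w \<in> space M. coef R k t i w = v $ i}"
      by (auto simp: value_of_def)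
    then show "prob (source_var R (Coef k t i) -` value_of (Coef k t i) \<inter> space M) = 1 / 2"
      by (simp add: coef_prob_bit)
  qed
  finally show ?thesis
    by (simp add: bob_prob power_one_over)
qed

text \<open>
  A packet is innovative unless its vector lies in the space \<open>W\<close> already received. Of the \<open>2 ^ N\<close>
  equally likely vectors, a subspace contains exactly \<open>2 ^ vec.dim W\<close>.
\<close>

lemma innovation_prob:
  fixes W :: "(bit ^ 'n) set"
  assumes "vec.subspace W"
  shows "prob {w \<in> space M. bob R k t w \<and> coding_vector R k t w \<notin> W}
    = P\<^sub>B * (1 - 2 ^ vec.dim W / 2 ^ CARD('n))"
proof -
  have [measurable]: "coding_vector R k t \<in> measurable M (count_space UNIV)"
    "bob R k t \<in> measurable M (count_space UNIV)"
    by (intro measurable_coding_vector measurable_of_source_var measurable_source_var)+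
  have ev: "{w \<in> space M. bob R k t w \<and> coding_vector R k t w = v} \<in> events" for v
    by measurable
  have "{w \<in> space M. bob R k t w \<and> coding_vector R k t w \<notin> W}
      = (\<Union>v\<in>- W. {w \<in> space M. bob R k t w \<and> coding_vector R k t w = v})"
    by auto
  then have "prob {w \<in> space M. bob R k t w \<and> coding_vector R k t w \<notin> W}
      = (\<Sum>v\<in>- W. prob {w \<in> space M. bob R k t w \<and> coding_vector R k t w = v})"
    by (simp only:, intro finite_measure_finite_Union) (auto simp: ev disjoint_family_on_def)
  also have "\<dots> = real (card (- W)) * (P\<^sub>B / 2 ^ CARD('n))"
    by (simp add: slot_law)
  also have "real (card (- W)) = 2 ^ CARD('n) - 2 ^ vec.dim W"
  proof -
    have "card (- W) = CARD(bit ^ 'n) - card W"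
      by (simp add: Compl_eq_Diff_UNIV card_Diff_subset)
    moreover have "card W \<le> CARD(bit ^ 'n)"
      by (rule card_mono) auto
    ultimately show ?thesis
      using card_subspace_bit[OF assms] by (simp add: card_UNIV_bit of_nat_diff)
  qed
  finally show ?thesis
    by (simp add: field_simps)
qed

lemma slot_indep:
  "indep_pair (\<lambda>w. row_space (bob_matrix R k t w)) (\<lambda>w. (bob R k t w, coding_vector R k t w))"
proof -
  have disjoint: "bob_sources k t \<inter> slot_sources k t = {}"
    by (auto simp: bob_sources_def slot_sources_def)
  have past: "(\<lambda>\<omega> :: 'n source \<Rightarrow> 'n outcome. row_space (bob_matrix path_model k t \<omega>))
      \<in> measurable (PiM (bob_sources k t) (\<lambda>_. count_space UNIV)) (count_space UNIV)"
    by (rule measurable_compose[OF measurable_bob_matrix[OF measurable_source_path_model]]) auto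
  have "bob (path_model :: ('n source \<Rightarrow> 'n outcome, 'n) rlnc) k t
      \<in> measurable (PiM (slot_sources k t) (\<lambda>_. count_space UNIV)) (count_space UNIV)"
    by (rule measurable_of_source_var measurable_source_path_model)+ (simp add: slot_sources_def)
  moreover have "coding_vector (path_model :: ('n source \<Rightarrow> 'n outcome, 'n) rlnc) k t
      \<in> measurable (PiM (slot_sources k t) (\<lambda>_. count_space UNIV)) (count_space UNIV)"
    by (rule measurable_coding_vector measurable_of_source_var measurable_source_path_model)+
      (simp add: slot_sources_def)
  ultimately have present: "(\<lambda>\<omega> :: 'n source \<Rightarrow> 'n outcome. (bob path_model k t \<omega>, coding_vector path_model k t \<omega>))
      \<in> measurable (PiM (slot_sources k t) (\<lambda>_. count_space UNIV)) (count_space UNIV)"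
    by (rule measurable_count_space_binary[where h = Pair])
  have "row_space (bob_matrix path_model k t (\<lambda>s\<in>bob_sources k t. source_var R s w))
      = row_space (bob_matrix R k t w)" for w
    by (simp only: bob_matrix_path_model[OF order_refl, of R, symmetric])
  moreover have "bob path_model k t (\<lambda>s\<in>slot_sources k t. source_var R s w) = bob R k t w"
    "coding_vector path_model k t (\<lambda>s\<in>slot_sources k t. source_var R s w) = coding_vector R k t w" for w
    by (simp_all add: path_model_def slot_sources_def coding_vector_def)
  ultimately show ?thesis
    using indep_pair_restrict[OF indep disjoint _ _ past present] by simp
qed

definition raise_prob :: "nat \<Rightarrow> real"
  where "raise_prob r = P\<^sub>B * (1 - 2 ^ r / 2 ^ CARD('n))"

lemma measurable_bob_matrix_model [measurable]:
  "bob_matrix R k t \<in> measurable M (count_space UNIV)"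
  by (intro measurable_bob_matrix measurable_source_var)

lemma measurable_rank: "(\<lambda>w. matrix_rank (bob_matrix R k t w)) \<in> measurable M (count_space UNIV)"
  by (rule measurable_compose[OF measurable_bob_matrix_model]) simp

text \<open>
  The present slot is independent of the row space of the past, and the probability of an innovative
  packet depends on that space through its dimension only. Hence the rank is a pure birth chain.
\<close>

lemma rank_raise:
  "prob {w \<in> space M. matrix_rank (bob_matrix R k t w) = r \<and> matrix_rank (bob_matrix R k (Suc t) w) = Suc r}
    = raise_prob r * prob {w \<in> space M. matrix_rank (bob_matrix R k t w) = r}"
proof -
  define S where "S = {W :: (bit ^ 'n) set. vec.subspace W \<and> vec.dim W = r}"
  have S: "row_space A \<in> S \<longleftrightarrow> matrix_rank A = r" for A
    by (simp add: S_def row_space_def matrix_rank_row_space[unfolded row_space_def] vec.subspace_span)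
  have "prob {w \<in> space M. row_space (bob_matrix R k t w) \<in> S \<and>
        (bob R k t w, coding_vector R k t w) \<in> {True} \<times> - row_space (bob_matrix R k t w)}
      = raise_prob r * prob {w \<in> space M. row_space (bob_matrix R k t w) \<in> S}"
    by (rule indep_pair_conditional[OF slot_indep, where G = "\<lambda>W. {True} \<times> - W"])
      (auto simp: S_def raise_prob_def innovation_prob)
  moreover have "row_space (bob_matrix R k t w) \<in> S \<and>
        (bob R k t w, coding_vector R k t w) \<in> {True} \<times> - row_space (bob_matrix R k t w)
      \<longleftrightarrow> matrix_rank (bob_matrix R k t w) = r \<and> matrix_rank (bob_matrix R k (Suc t) w) = Suc r" for w
    by (auto simp: S bob_matrix_Suc matrix_rank_snoc)
  ultimately show ?thesis
    by (simp only: S)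
qed

lemma rank_sojourn_sums:
  assumes "P\<^sub>B > 0" "r < CARD('n)"
  shows "(\<lambda>t. prob {w \<in> space M. matrix_rank (bob_matrix R k t w) = r}) sums (1 / raise_prob r)"
proof (rule birth_sojourn_prob_sums[where n = "CARD('n)"])
  show "0 < raise_prob r" if "r < CARD('n)" for r
    using that \<open>P\<^sub>B > 0\<close> by (simp add: raise_prob_def)
  show "matrix_rank (bob_matrix R k (Suc t) w) = matrix_rank (bob_matrix R k t w)
      \<or> matrix_rank (bob_matrix R k (Suc t) w) = Suc (matrix_rank (bob_matrix R k t w))" for t w
    by (simp add: bob_matrix_Suc matrix_rank_snoc)
  show "matrix_rank (bob_matrix R k 0 w) = 0" for w
    by (simp add: bob_matrix_def matrix_rank_Nil)
qed (rule measurable_rank rank_raise assms)+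

lemma rank_mono: "s \<le> t \<Longrightarrow> matrix_rank (bob_matrix R k s w) \<le> matrix_rank (bob_matrix R k t w)"
  by (rule lift_Suc_mono_le[where f = "\<lambda>t. matrix_rank (bob_matrix R k t w)"])
    (simp_all add: bob_matrix_Suc matrix_rank_snoc)

text \<open>
  The time with incomplete rank splits into the sojourn times at the ranks \<open>r < N\<close>, of mean
  \<open>1 / raise_prob r\<close>. With \<open>i = N - r\<close> such a mean is \<open>(1 + 1 / (2 ^ i - 1)) / P\<^sub>B\<close>, whose
  second summand gives the overhead.
\<close>

lemma incomplete_sums:
  assumes "P\<^sub>B > 0"
  shows "(\<lambda>t. prob {w \<in> space M. matrix_rank (bob_matrix R k t w) < CARD('n)})
    sums ((CARD('n) + mean_overhead CARD('n)) / P\<^sub>B)"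
proof -
  note measurable_rank[measurable]
  have "prob {w \<in> space M. matrix_rank (bob_matrix R k t w) < CARD('n)}
      = (\<Sum>r<CARD('n). prob {w \<in> space M. matrix_rank (bob_matrix R k t w) = r})" for t
  proof -
    have "{w \<in> space M. matrix_rank (bob_matrix R k t w) < CARD('n)}
        = (\<Union>r<CARD('n). {w \<in> space M. matrix_rank (bob_matrix R k t w) = r})"
      by auto
    then show ?thesis
      by (simp only:, intro finite_measure_finite_Union) (auto simp: disjoint_family_on_def)
  qed
  moreover have "(\<lambda>t. \<Sum>r<CARD('n). prob {w \<in> space M. matrix_rank (bob_matrix R k t w) = r})
      sums (\<Sum>r<CARD('n). 1 / raise_prob r)"
    by (intro sums_sum rank_sojourn_sums assms) simp
  moreover have "(\<Sum>r<CARD('n). 1 / raise_prob r) = (CARD('n) + mean_overhead CARD('n)) / P\<^sub>B"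
  proof -
    \<comment> \<open>The reindexing \<open>i = N - r\<close> counts the missing dimensions.\<close>
    have "(\<Sum>r<CARD('n). 1 / raise_prob r) = (\<Sum>i=1..CARD('n). 1 / raise_prob (CARD('n) - i))"
      by (rule sum.reindex_bij_witness[of _ "\<lambda>i. CARD('n) - i" "\<lambda>r. CARD('n) - r"]) auto
    also have "\<dots> = (\<Sum>i=1..CARD('n). (1 + 1 / (2 ^ i - 1)) / P\<^sub>B)"
    proof (rule sum.cong[OF refl])
      fix i assume i: "i \<in> {1..CARD('n)}"
      define x :: real where "x = 2 ^ i"
      have "x > 1"
        using i by (simp add: x_def)
      have "2 ^ (CARD('n) - i) / 2 ^ CARD('n) = 1 / x"
        using i by (simp add: x_def power_diff)
      then have "1 / raise_prob (CARD('n) - i) = 1 / (P\<^sub>B * ((x - 1) / x))"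
        using \<open>x > 1\<close> by (simp add: raise_prob_def diff_divide_distrib)
      also have "\<dots> = x / (x - 1) / P\<^sub>B"
        by simp
      also have "x / (x - 1) = 1 + 1 / (x - 1)"
        using \<open>x > 1\<close> by (simp add: field_simps)
      finally show "1 / raise_prob (CARD('n) - i) = (1 + 1 / (2 ^ i - 1)) / P\<^sub>B"
        by (simp add: x_def)
    qed
    also have "\<dots> = (CARD('n) + mean_overhead CARD('n)) / P\<^sub>B"
      by (simp add: mean_overhead_def sum_divide_distrib[symmetric] sum.distrib)
    finally show ?thesis .
  qed
  ultimately show ?thesis
    by simp
qed

lemma AE_decodable:
  assumes "P\<^sub>B > 0"
  shows "AE w in M. \<forall>k. \<exists>t. matrix_rank (bob_matrix R k t w) = CARD('n)"
  unfolding AE_all_countable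
proof
  fix k
  note measurable_rank[measurable]
  let ?never = "{w \<in> space M. \<forall>t. matrix_rank (bob_matrix R k t w) < CARD('n)}"
  have "prob ?never \<le> prob {w \<in> space M. matrix_rank (bob_matrix R k t w) < CARD('n)}" for t
    by (rule finite_measure_mono) auto
  then have "prob ?never \<le> 0"
    using sums_summable[OF incomplete_sums[OF assms, of k]]
    by (intro LIMSEQ_le_const[OF summable_LIMSEQ_zero]) auto
  then have "prob ?never = 0"
    by (simp add: measure_le_0_iff)
  then have "AE w in M. \<not> (\<forall>t. matrix_rank (bob_matrix R k t w) < CARD('n))"
    by (subst AE_iff_measurable[OF _ refl]) (auto simp: emeasure_eq_measure)
  then show "AE w in M. \<exists>t. matrix_rank (bob_matrix R k t w) = CARD('n)"
    by eventually_elim (metis matrix_rank_le nat_less_le)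
qed

text \<open>
  The event \<open>t < T\<close> says that the rank after \<open>t\<close> slots is incomplete, provided that Bob ever reaches
  full rank; the mean of \<open>T\<close> is the sum of the probabilities of these events.
\<close>

lemma expected_decoding_slot:
  assumes "P\<^sub>B > 0"
  shows "(\<integral>\<^sup>+w. of_nat (decoding_slot R k w) \<partial>M)
    = ennreal ((CARD('n) + mean_overhead CARD('n)) / P\<^sub>B)"
proof -
  note measurable_rank[measurable]
  have [measurable]: "decoding_slot R k \<in> measurable M (count_space UNIV)"
    by (intro measurable_decoding_slot measurable_source_var)
  have "emeasure M {w \<in> space M. t < decoding_slot R k w}
      = ennreal (prob {w \<in> space M. matrix_rank (bob_matrix R k t w) < CARD('n)})" for t
    unfolding emeasure_eq_measure[symmetric]
  proof (rule emeasure_eq_AE)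
    show "AE w in M. w \<in> {w \<in> space M. t < decoding_slot R k w}
      \<longleftrightarrow> w \<in> {w \<in> space M. matrix_rank (bob_matrix R k t w) < CARD('n)}"
      using AE_decodable[OF assms]
    proof eventually_elim
      case (elim w)
      then obtain s where s: "matrix_rank (bob_matrix R k s w) = CARD('n)"
        by blast
      have T: "matrix_rank (bob_matrix R k (decoding_slot R k w) w) = CARD('n)"
        unfolding decoding_slot_def using s by (rule LeastI)
      have "t < decoding_slot R k w \<longleftrightarrow> matrix_rank (bob_matrix R k t w) < CARD('n)"
      proof
        assume "t < decoding_slot R k w"
        then have "matrix_rank (bob_matrix R k t w) \<noteq> CARD('n)"
          unfolding decoding_slot_def by (rule not_less_Least)
        then show "matrix_rank (bob_matrix R k t w) < CARD('n)"
          using matrix_rank_le[of "bob_matrix R k t w"] by linarith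
      next
        assume "matrix_rank (bob_matrix R k t w) < CARD('n)"
        then show "t < decoding_slot R k w"
          using rank_mono[of "decoding_slot R k w" t k w] T by (cases "t < decoding_slot R k w") auto
      qed
      then show ?case
        by simp
    qed
  qed measurable
  then show ?thesis
    using incomplete_sums[OF assms, of k]
    by (simp add: nn_integral_nat_function suminf_ennreal2 sums_iff)
qed

end

section \<open>Blocks are independent and identically distributed\<close>

context rlnc_model
begin

text \<open>
  Bits and receptions have a law on a two-point type, which is determined by one probability. The laws
  of the delay and of the dummy positions agree across blocks by assumption.
\<close>

lemma source_law_shift:
  "distr M (count_space UNIV) (source_var R (shift_block k s))
    = distr M (count_space UNIV) (source_var R s)"
proof -
  have meas: "coef R k j i \<in> measurable M (count_space UNIV)" "bob R k j \<in> measurable M (count_space UNIV)"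
    "eve R k j \<in> measurable M (count_space UNIV)" "ack R k \<in> measurable M (count_space UNIV)"
    "dummies R k \<in> measurable M (count_space UNIV)" for k j i
    by (intro measurable_of_source_var measurable_source_var)+
  have lift: "distr M (count_space UNIV) (\<lambda>w. g (X w)) = distr M (count_space UNIV) (\<lambda>w. g (Y w))"
    if "distr M (count_space UNIV) X = distr M (count_space UNIV) Y"
      "X \<in> measurable M (count_space UNIV)" "Y \<in> measurable M (count_space UNIV)"
    for X Y :: "'w \<Rightarrow> 'b" and g :: "'b \<Rightarrow> 'n outcome"
    using arg_cong[OF that(1), of "\<lambda>D. distr D (count_space UNIV) g"] that(2,3)
    by (simp add: distr_distr comp_def)
  \<comment> \<open>A law on a countable type is determined by its point masses.\<close>
  have discrete: "distr M (count_space UNIV) X = distr M (count_space UNIV) Y"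
    if "X \<in> measurable M (count_space UNIV)" "Y \<in> measurable M (count_space UNIV)"
      "\<And>x. prob {w \<in> space M. X w = x} = prob {w \<in> space M. Y w = x}"
    for X Y :: "'w \<Rightarrow> 'b::countable"
  proof (rule measure_eqI_countable[where A = UNIV])
    fix x
    have "X -` {x} \<inter> space M = {w \<in> space M. X w = x}" "Y -` {x} \<inter> space M = {w \<in> space M. Y w = x}"
      by auto
    then show "emeasure (distr M (count_space UNIV) X) {x} = emeasure (distr M (count_space UNIV) Y) {x}"
      using that by (simp add: emeasure_distr emeasure_eq_measure)
  qed auto
  have bool: "prob {w \<in> space M. X w = x} = prob {w \<in> space M. Y w = x}"
    if "X \<in> measurable M (count_space UNIV)" "Y \<in> measurable M (count_space UNIV)"
      "prob {w \<in> space M. X w} = prob {w \<in> space M. Y w}"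
    for X Y :: "'w \<Rightarrow> bool" and x
  proof (cases x)
    case False
    have "{w \<in> space M. Z w = False} = space M - {w \<in> space M. Z w}" for Z
      by auto
    then show ?thesis
      using False that prob_compl[of "{w \<in> space M. X w}"] prob_compl[of "{w \<in> space M. Y w}"]
      by (simp add: pred_def)
  qed (use that in simp)
  have eta: "source_var R (Coef k j i) = (\<lambda>w. Entry (coef R k j i w))"
    "source_var R (Bob k j) = (\<lambda>w. Received (bob R k j w))"
    "source_var R (Eve k j) = (\<lambda>w. Received (eve R k j w))"
    "source_var R (Ack k) = (\<lambda>w. Delay (ack R k w))"
    "source_var R (Dummies k) = (\<lambda>w. Positions (dummies R k w))" for k j i
    by (simp_all add: fun_eq_iff)
  show ?thesis
  proof (cases s)
    case (Coef l j i)
    have "distr M (count_space UNIV) (coef R k j i) = distr M (count_space UNIV) (coef R l j i)"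
      by (intro discrete meas) (simp add: coef_prob_bit)
    from lift[OF this meas(1) meas(1)] show ?thesis
      unfolding Coef shift_block.simps eta .
  next
    case (Bob l j)
    have "distr M (count_space UNIV) (bob R k j) = distr M (count_space UNIV) (bob R l j)"
      by (intro discrete meas bool) (simp add: bob_prob)
    from lift[OF this meas(2) meas(2)] show ?thesis
      unfolding Bob shift_block.simps eta .
  next
    case (Eve l j)
    have "distr M (count_space UNIV) (eve R k j) = distr M (count_space UNIV) (eve R l j)"
      by (intro discrete meas bool) (simp add: eve_prob)
    from lift[OF this meas(3) meas(3)] show ?thesis
      unfolding Eve shift_block.simps eta .
  next
    case (Ack l)
    from lift[OF ack_identical meas(4) meas(4)] show ?thesis
      unfolding Ack shift_block.simps eta .
  next
    case (Dummies l)
    from lift[OF dummies_identical meas(5) meas(5)] show ?thesis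
      unfolding Dummies shift_block.simps eta .
  qed
qed

text \<open>
  The sources of block \<open>k\<close>, relabelled as those of block \<open>0\<close>, so that all blocks have their values in
  the same space and their laws can be compared.
\<close>

definition block_path :: "nat \<Rightarrow> 'w \<Rightarrow> 'n source \<Rightarrow> 'n outcome"
  where "block_path k w = (\<lambda>s\<in>block_sources 0. source_var R (shift_block k s) w)"

text \<open>
  Independence makes the law of a block the product of the laws of its sources, and these do not
  depend on the block.
\<close>

lemma block_path_law:
  "distr M (PiM (block_sources 0) (\<lambda>_. count_space UNIV)) (block_path k)
    = (\<Pi>\<^sub>M s\<in>block_sources 0. distr M (count_space UNIV) (source_var R s))"
proof -
  let ?law = "\<lambda>s. distr M (count_space UNIV) (source_var R s)"
  have inj: "inj_on (shift_block k) (block_sources 0 :: 'n source set)"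
  proof (rule inj_onI)
    fix s s' :: "'n source"
    assume "s \<in> block_sources 0" "s' \<in> block_sources 0" "shift_block k s = shift_block k s'"
    then show "s = s'"
      by (cases s; cases s') auto
  qed
  have all: "distr M (\<Pi>\<^sub>M s\<in>UNIV. count_space UNIV) (\<lambda>w. \<lambda>s\<in>UNIV. source_var R s w) = (\<Pi>\<^sub>M s\<in>UNIV. ?law s)"
    using indep by (subst (asm) indep_vars_iff_distr_eq_PiM) auto
  have "(\<Pi>\<^sub>M s\<in>block_sources 0. ?law (shift_block k s))
      = distr (\<Pi>\<^sub>M s\<in>UNIV. ?law s) (\<Pi>\<^sub>M s\<in>block_sources 0. ?law (shift_block k s))
          (\<lambda>\<omega>. \<lambda>s\<in>block_sources 0. \<omega> (shift_block k s))"
    by (rule distr_PiM_reindex[where M = ?law and f = "shift_block k" and K = UNIV, symmetric])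
      (auto intro: prob_space_distr inj)
  also have "\<dots> = distr (distr M (\<Pi>\<^sub>M s\<in>UNIV. count_space UNIV) (\<lambda>w. \<lambda>s\<in>UNIV. source_var R s w))
          (PiM (block_sources 0) (\<lambda>_. count_space UNIV)) (\<lambda>\<omega>. \<lambda>s\<in>block_sources 0. \<omega> (shift_block k s))"
    unfolding all by (intro distr_cong refl sets_PiM_cong) simp_all
  also have "\<dots> = distr M (PiM (block_sources 0) (\<lambda>_. count_space UNIV)) (block_path k)"
    by (subst distr_distr) (auto simp: comp_def block_path_def[abs_def] intro!: measurable_restrict)
  finally show ?thesis
    using source_law_shift by (simp cong: PiM_cong)
qed

text \<open>
  An incidence is the same event for every block in terms of the relabelled sources.
\<close>

lemma asy_prob_identical: "asy_prob M R k = asy_prob M R l"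
proof -
  let ?N = "PiM (block_sources 0) (\<lambda>_. count_space UNIV) :: ('n source \<Rightarrow> 'n outcome) measure"
  have path: "block_path k \<in> measurable M ?N" for k
    unfolding block_path_def[abs_def] by (intro measurable_restrict measurable_source_var)
  have [measurable]: "Measurable.pred ?N (asynchronized path_model 0)"
    by (intro measurable_asynchronized measurable_source_path_model)
  have "asy_prob M R k = measure (distr M ?N (block_path k)) {\<omega> \<in> space ?N. asynchronized path_model 0 \<omega>}" for k
  proof -
    have "asynchronized R k w = asynchronized path_model 0 (block_path k w)" for w
      by (rule block_cong[THEN conjunct2]) (simp_all add: path_model_def block_path_def)
    then have "{w \<in> space M. asynchronized R k w}
        = block_path k -` {\<omega> \<in> space ?N. asynchronized path_model 0 \<omega>} \<inter> space M"
      using measurable_space[OF path] by auto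
    then show ?thesis
      unfolding asy_prob_def by (simp add: measure_distr[OF path])
  qed
  then show ?thesis
    by (simp add: block_path_law)
qed

lemma block_indep:
  "indep_vars (\<lambda>_. count_space UNIV) (\<lambda>k w. (final_slot R k w, asynchronized R k w)) UNIV"
proof -
  have restrict: "(final_slot R k w, asynchronized R k w)
      = (\<lambda>\<omega>. (final_slot path_model k \<omega>, asynchronized path_model k \<omega>))
          (\<lambda>s\<in>block_sources k. source_var R s w)" for k w
    using block_cong[of R k w path_model k "\<lambda>s\<in>block_sources k. source_var R s w"]
    by (simp add: path_model_def)
  have "(\<lambda>\<omega>. (final_slot path_model k \<omega>, asynchronized path_model k \<omega>))
      \<in> measurable (PiM (block_sources k) (\<lambda>_. count_space UNIV)) (count_space UNIV)" for k
    by (intro measurable_count_space_binary[where h = Pair] measurable_final_slot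
        measurable_asynchronized measurable_source_path_model)
  moreover have "indep_vars (\<lambda>k. PiM (block_sources k) (\<lambda>_. count_space UNIV))
      (\<lambda>k w. \<lambda>s\<in>block_sources k. source_var R s w) UNIV"
    by (rule indep_vars_restrict[OF indep]) (auto simp: disjoint_family_on_def disjoint_block_sources)
  ultimately show ?thesis
    unfolding restrict by (rule indep_vars_compose2[rotated])
qed

text \<open>
  The mean acknowledgment delay is known to exist for a single block \<open>b\<close>; equality of the laws carries
  it to block \<open>k\<close>.
\<close>

lemma expected_final_slot:
  assumes "P\<^sub>B > 0" and ack: "integrable M (\<lambda>w. real (ack R b w))"
  shows "(\<integral>\<^sup>+w. of_nat (final_slot R k w) \<partial>M)
    = ennreal ((CARD('n) + mean_overhead CARD('n)) / P\<^sub>B + (\<integral>w. real (ack R b w) \<partial>M))"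
proof -
  have [measurable]: "decoding_slot R k \<in> measurable M (count_space UNIV)"
    by (intro measurable_decoding_slot measurable_source_var)
  have [measurable]: "ack R k \<in> measurable M (count_space UNIV)" for k
    by (intro measurable_of_source_var measurable_source_var)
  have "(\<integral>\<^sup>+w. of_nat (ack R k w) \<partial>M) = (\<integral>\<^sup>+w. of_nat (ack R b w) \<partial>M)"
    using arg_cong[OF ack_identical[of k b], of "\<lambda>D. \<integral>\<^sup>+d. of_nat d \<partial>D"] by (simp add: nn_integral_distr)
  also have "\<dots> = ennreal (\<integral>w. real (ack R b w) \<partial>M)"
    using nn_integral_eq_integral[OF ack] by (simp add: ennreal_of_nat_eq_real_of_nat)
  finally have "(\<integral>\<^sup>+w. of_nat (final_slot R k w) \<partial>M)
      = ennreal ((CARD('n) + mean_overhead CARD('n)) / P\<^sub>B) + ennreal (\<integral>w. real (ack R b w) \<partial>M)"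
    unfolding final_slot_def of_nat_add
    by (subst nn_integral_add) (simp_all add: expected_decoding_slot[OF \<open>P\<^sub>B > 0\<close>])
  moreover have "0 \<le> mean_overhead CARD('n)"
    by (auto simp: mean_overhead_def intro!: sum_nonneg)
  ultimately show ?thesis
    using \<open>P\<^sub>B > 0\<close> by (simp add: ennreal_plus)
qed

end

section \<open>Rewards between incidences\<close>

text \<open>
  The index of the interval between incidences to which block \<open>k\<close> belongs. It is determined by the
  blocks before \<open>k\<close>, which makes it independent of the length of block \<open>k\<close> itself.
\<close>

definition incidences_before :: "(nat \<Rightarrow> 'w \<Rightarrow> bool) \<Rightarrow> nat \<Rightarrow> 'w \<Rightarrow> nat"
  where "incidences_before A k w = card {j. j < k \<and> A j w}"

lemma incidences_before_0: "incidences_before A 0 w = 0"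
  by (simp add: incidences_before_def)

lemma incidences_before_Suc:
  "incidences_before A (Suc k) w = (if A k w then Suc (incidences_before A k w) else incidences_before A k w)"
proof -
  have "{j. j < Suc k \<and> A j w} = (if A k w then insert k {j. j < k \<and> A j w} else {j. j < k \<and> A j w})"
    by (auto simp: less_Suc_eq)
  then show ?thesis
    by (simp add: incidences_before_def)
qed

lemma measurable_incidences_before:
  assumes "\<And>j. j < k \<Longrightarrow> Measurable.pred M (A j)"
  shows "incidences_before A k \<in> measurable M (count_space UNIV)"
  using assms
proof (induction k)
  case 0
  then show ?case
    by (simp add: incidences_before_0[abs_def])
next
  case (Suc k)
  have [measurable]: "Measurable.pred M (A k)" "incidences_before A k \<in> measurable M (count_space UNIV)"
    using Suc by auto
  show ?case
    unfolding incidences_before_Suc[abs_def] by measurable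
qed

text \<open>
  Position \<open>k\<close> is not beyond the element number \<open>m\<close>, counted from \<open>0\<close>, exactly if at most \<open>m\<close> elements
  precede it. This turns a sum up to a random block into a sum over all blocks with an indicator.
\<close>

lemma enumerate_ge_iff_card_le:
  fixes S :: "nat set"
  assumes "infinite S"
  shows "k \<le> enumerate S m \<longleftrightarrow> card {j. j < k \<and> j \<in> S} \<le> m"
proof
  assume k: "k \<le> enumerate S m"
  have "{j. j < k \<and> j \<in> S} \<subseteq> enumerate S ` {..<m}"
  proof
    fix j assume j: "j \<in> {j. j < k \<and> j \<in> S}"
    then obtain n where n: "enumerate S n = j"
      using enumerate_Ex[OF \<open>infinite S\<close>] by blast
    then have "n < m"
      using j k enumerate_mono_iff[OF \<open>infinite S\<close>, of n m] by simp
    then show "j \<in> enumerate S ` {..<m}"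
      using n by blast
  qed
  then show "card {j. j < k \<and> j \<in> S} \<le> m"
    using surj_card_le[of "{..<m}"] by simp
next
  assume card: "card {j. j < k \<and> j \<in> S} \<le> m"
  show "k \<le> enumerate S m"
  proof (rule ccontr)
    assume "\<not> k \<le> enumerate S m"
    then have "enumerate S ` {..m} \<subseteq> {j. j < k \<and> j \<in> S}"
      using enumerate_mono_le_iff[OF \<open>infinite S\<close>] enumerate_in_set[OF \<open>infinite S\<close>]
      by (auto simp: not_le intro: le_less_trans)
    then have "card (enumerate S ` {..m}) \<le> card {j. j < k \<and> j \<in> S}"
      by (intro card_mono) auto
    moreover have "card (enumerate S ` {..m}) = Suc m"
      using card_image[of "enumerate S" "{..m}"] inj_enumerate[OF \<open>infinite S\<close>] by (simp add: inj_on_subset)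
    ultimately show False
      using card by simp
  qed
qed

lemma incidences_before_le_iff:
  assumes "infinite {k. A k w}"
  shows "incidences_before A k w \<le> m \<longleftrightarrow> k \<le> enumerate {k. A k w} m"
  using enumerate_ge_iff_card_le[OF assms, of k m] by (simp add: incidences_before_def)

text \<open>
  Holds for all \<open>w\<close>, including those with finitely many incidences: the recursion of
  \<^const>\<open>enumerate\<close> removes the least element, which is a measurable function of \<open>w\<close> in
  any case. The measure need not be complete, so that a statement up to null sets would not do.
\<close>

lemma measurable_enumerate:
  fixes A :: "nat \<Rightarrow> 'w \<Rightarrow> bool"
  assumes "\<And>k. Measurable.pred M (A k)"
  shows "(\<lambda>w. enumerate {k. A k w} m) \<in> measurable M (count_space UNIV)"
  using assms
proof (induction m arbitrary: A)
  case 0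
  show ?case
    unfolding enumerate_0 mem_Collect_eq by (rule measurable_Least) (rule 0)
next
  case (Suc m)
  have [measurable]: "(\<lambda>w. LEAST n. A n w) \<in> measurable M (count_space UNIV)"
    by (rule measurable_Least) (rule Suc.prems)
  have "(\<lambda>w. enumerate {k. A k w \<and> (LEAST n. A n w) \<noteq> k} m) \<in> measurable M (count_space UNIV)"
  proof (rule Suc.IH)
    fix k
    have [measurable]: "Measurable.pred M (A k)"
      by (rule Suc.prems)
    show "Measurable.pred M (\<lambda>w. A k w \<and> (LEAST n. A n w) \<noteq> k)"
      by measurable
  qed
  moreover have "{k. A k w} - {LEAST n. n \<in> {k. A k w}} = {k. A k w \<and> (LEAST n. A n w) \<noteq> k}" for w
    by auto
  ultimately show ?case
    by (simp only: enumerate_Suc)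
qed

text \<open>
  The factorization is applied to each tail event \<open>t < X\<close> in the layer-cake sum of the
  expectation of \<open>X\<close>.
\<close>

lemma (in prob_space) nn_integral_restrict_nat:
  assumes indep: "indep_pair X Y"
  shows "(\<integral>\<^sup>+w. of_nat (if Y w \<in> T then X w else 0 :: nat) \<partial>M)
    = (\<integral>\<^sup>+w. of_nat (X w) \<partial>M) * ennreal (prob {w \<in> space M. Y w \<in> T})"
proof -
  have X [measurable]: "X \<in> measurable M (count_space UNIV)" and Y: "Y \<in> measurable M (count_space UNIV)"
    using indep by (simp_all add: indep_pair_def)
  have [measurable]: "Measurable.pred M (\<lambda>w. Y w \<in> T)"
    by (rule measurable_compose[OF Y]) simp
  have "emeasure M {w \<in> space M. t < (if Y w \<in> T then X w else 0)}
      = emeasure M {w \<in> space M. t < X w} * ennreal (prob {w \<in> space M. Y w \<in> T})" for t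
  proof -
    have "{w \<in> space M. t < (if Y w \<in> T then X w else 0)} = {w \<in> space M. X w \<in> {t<..} \<and> Y w \<in> T}"
      by auto
    moreover have "prob {w \<in> space M. X w \<in> {t<..} \<and> Y w \<in> T}
        = prob {w \<in> space M. X w \<in> {t<..}} * prob {w \<in> space M. Y w \<in> T}"
      using indep unfolding indep_pair_def by blast
    ultimately show ?thesis
      by (simp add: emeasure_eq_measure ennreal_mult)
  qed
  then show ?thesis
    by (simp add: nn_integral_nat_function)
qed

context prob_space
begin

text \<open>
  With a summable sojourn in every state, the probability that the count is still at most \<open>m\<close> tends to
  \<open>0\<close>, so that the count is almost surely unbounded.
\<close>

lemma AE_infinitely_many_incidences:
  fixes A :: "nat \<Rightarrow> 'a \<Rightarrow> bool"
  assumes A: "\<And>k. Measurable.pred M (A k)"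
    and sojourn: "\<And>m. summable (\<lambda>k. prob {w \<in> space M. incidences_before A k w = m})"
  shows "AE w in M. infinite {k. A k w}"
proof -
  have [measurable]: "incidences_before A k \<in> measurable M (count_space UNIV)" for k
    by (intro measurable_incidences_before A)
  have "AE w in M. \<not> (\<forall>k. incidences_before A k w \<le> m)" for m
  proof -
    let ?few = "\<lambda>k. {w \<in> space M. incidences_before A k w \<le> m}"
    have "prob (?few k) = (\<Sum>i\<le>m. prob {w \<in> space M. incidences_before A k w = i})" for k
    proof -
      have "?few k = (\<Union>i\<le>m. {w \<in> space M. incidences_before A k w = i})"
        by auto
      then show ?thesis
        by (simp only:, intro finite_measure_finite_Union) (auto simp: disjoint_family_on_def)
    qed
    then have "(\<lambda>k. prob (?few k)) \<longlonglongrightarrow> (\<Sum>i\<le>m. 0)"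
      by (simp only:, intro tendsto_sum summable_LIMSEQ_zero sojourn)
    then have lim: "(\<lambda>k. prob (?few k)) \<longlonglongrightarrow> 0"
      by simp
    have "prob {w \<in> space M. \<forall>k. incidences_before A k w \<le> m} \<le> prob (?few k)" for k
      by (rule finite_measure_mono) auto
    then have "prob {w \<in> space M. \<forall>k. incidences_before A k w \<le> m} \<le> 0"
      by (intro LIMSEQ_le_const[OF lim]) auto
    then have "prob {w \<in> space M. \<forall>k. incidences_before A k w \<le> m} = 0"
      by (simp add: measure_le_0_iff)
    then show ?thesis
      by (subst AE_iff_measurable[OF _ refl]) (auto simp: emeasure_eq_measure)
  qed
  then have "AE w in M. \<forall>m. \<not> (\<forall>k. incidences_before A k w \<le> m)"
    by (simp add: AE_all_countable)
  then show ?thesis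
  proof eventually_elim
    case (elim w)
    show ?case
    proof
      assume fin: "finite {k. A k w}"
      then have "incidences_before A k w \<le> card {k. A k w}" for k
        unfolding incidences_before_def by (intro card_mono) auto
      then show False
        using elim by blast
    qed
  qed
qed

text \<open>
  Block \<open>k\<close> contributes its length to interval \<open>m\<close> exactly if \<open>m\<close> incidences occurred before it. This
  event is independent of its length, so the contribution has mean \<open>\<mu>\<close> times the probability of the
  event. The count of incidences is a pure birth chain that moves with probability \<open>p\<close>, so these
  probabilities sum to \<open>1 / p\<close>, for every \<open>m\<close>. The intervals before the first incidence and
  between two consecutive ones are thereby treated alike. The pairs \<open>(L k, A k)\<close> are independent
  across blocks; within a block, the length and the incidence may depend on each other.
\<close>
theorem renewal_reward:
  fixes L :: "nat \<Rightarrow> 'a \<Rightarrow> nat" and A :: "nat \<Rightarrow> 'a \<Rightarrow> bool"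
  assumes indep: "indep_vars (\<lambda>_. count_space UNIV) (\<lambda>k w. (L k w, A k w)) UNIV"
    and mean: "\<And>k. (\<integral>\<^sup>+w. of_nat (L k w) \<partial>M) = ennreal \<mu>" and "0 \<le> \<mu>"
    and prob_A: "\<And>k. prob {w \<in> space M. A k w} = p" and "0 < p"
  shows "AE w in M. infinite {k. A k w}"
    and "(\<integral>\<^sup>+w. (\<Sum>k. of_nat (if incidences_before A k w = m then L k w else 0)) \<partial>M) = ennreal (\<mu> / p)"
proof -
  have LA: "(\<lambda>w. (L k w, A k w)) \<in> measurable M (count_space UNIV)" for k
    using indep by (simp add: indep_vars_def)
  have L [measurable]: "L k \<in> measurable M (count_space UNIV)"
    and A [measurable]: "Measurable.pred M (A k)" for k
    using measurable_compose[OF LA, of fst "count_space UNIV"] measurable_compose[OF LA, of snd "count_space UNIV"]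
    by simp_all
  have N [measurable]: "incidences_before A k \<in> measurable M (count_space UNIV)" for k
    by (intro measurable_incidences_before A)
  have past_indep: "indep_pair (\<lambda>w. g (L k w, A k w)) (incidences_before A k)" for k and g :: "_ \<Rightarrow> 'b"
  proof -
    let ?past = "incidences_before (\<lambda>j y. snd (y j)) k :: (nat \<Rightarrow> nat \<times> bool) \<Rightarrow> nat"
    have "?past \<in> measurable (PiM {..<k} (\<lambda>_. count_space UNIV)) (count_space UNIV)"
      by (intro measurable_incidences_before measurable_compose[OF measurable_component_singleton, of _ "{..<k}"]) auto
    moreover have "(\<lambda>y. g (y k)) \<in> measurable (PiM {k} (\<lambda>_. count_space UNIV)) (count_space UNIV)"
      by (intro measurable_compose[OF measurable_component_singleton]) auto
    ultimately have "indep_pair (\<lambda>w. g ((\<lambda>j\<in>{k}. (L j w, A j w)) k)) (\<lambda>w. ?past (\<lambda>j\<in>{..<k}. (L j w, A j w)))"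
      by (intro indep_pair_restrict[OF indep]) auto
    moreover have "?past (\<lambda>j\<in>{..<k}. (L j w, A j w)) = incidences_before A k w" for w
      unfolding incidences_before_def by (rule arg_cong[where f = card]) auto
    ultimately show ?thesis
      by simp
  qed
  \<comment> \<open>The chain never stops, so any bound above \<open>m\<close> on the states does.\<close>
  have sojourn: "(\<lambda>k. prob {w \<in> space M. incidences_before A k w = m}) sums (1 / p)" for m
  proof (rule birth_sojourn_prob_sums[where n = "Suc m" and c = "\<lambda>_. p"])
    show "prob {w \<in> space M. incidences_before A k w = r \<and> incidences_before A (Suc k) w = Suc r}
        = p * prob {w \<in> space M. incidences_before A k w = r}" for k r
    proof -
      have "{w \<in> space M. incidences_before A k w = r \<and> incidences_before A (Suc k) w = Suc r}
          = {w \<in> space M. A k w \<in> {True} \<and> incidences_before A k w \<in> {r}}"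
        by (auto simp: incidences_before_Suc)
      moreover have "prob {w \<in> space M. A k w \<in> {True} \<and> incidences_before A k w \<in> {r}}
          = prob {w \<in> space M. A k w \<in> {True}} * prob {w \<in> space M. incidences_before A k w \<in> {r}}"
        using past_indep[of snd k] unfolding indep_pair_def snd_conv by blast
      ultimately show ?thesis
        by (simp add: prob_A)
    qed
  qed (auto simp: incidences_before_0 incidences_before_Suc \<open>0 < p\<close>)
  show "AE w in M. infinite {k. A k w}"
    by (rule AE_infinitely_many_incidences[OF A sums_summable[OF sojourn]])
  have "(\<integral>\<^sup>+w. of_nat (if incidences_before A k w = m then L k w else 0) \<partial>M)
      = ennreal (\<mu> * prob {w \<in> space M. incidences_before A k w = m})" for k
    using nn_integral_restrict_nat[of "L k" "incidences_before A k" "{m}"] past_indep[of fst k]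
    by (simp add: mean ennreal_mult \<open>0 \<le> \<mu>\<close>)
  moreover have "(\<lambda>k. \<mu> * prob {w \<in> space M. incidences_before A k w = m}) sums (\<mu> / p)"
    using sums_mult[OF sojourn, of \<mu>] by simp
  ultimately show "(\<integral>\<^sup>+w. (\<Sum>k. of_nat (if incidences_before A k w = m then L k w else 0)) \<partial>M) = ennreal (\<mu> / p)"
    using \<open>0 \<le> \<mu>\<close> by (subst nn_integral_suminf) (auto simp: suminf_ennreal2 sums_iff)
qed

end


section \<open>The overhead is close to 1.6\<close>

text \<open>
  The overhead increases with \<open>N\<close> to \<open>1.6067\<close>. Up to \<open>N = 6\<close> the values are compared one by one. From
  \<open>N = 7\<close> on, the value \<open>1.5988\<close> at \<open>7\<close> is a lower bound, and the remaining terms are below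
  \<open>1 / (254 * 2 ^ d)\<close>, a geometric series with sum \<open>1 / 127\<close>; the two bounds lie within \<open>1 / 100\<close> of
  \<open>1.6\<close>.
\<close>

lemma mean_overhead_error: "\<bar>mean_overhead N - 1.6\<bar> \<le> max (1 / 100) (4 / 3 / 2 ^ N)" if "N \<ge> 1"
proof (cases "N \<le> 6")
  case True
  with that have "N \<in> {1, 2, 3, 4, 5, 6}"
    by auto
  then show ?thesis
    by (auto simp: mean_overhead_def numeral_eq_Suc max_def)
next
  case False
  then obtain d where N: "N = 7 + d"
    using le_Suc_ex[of 7 N] by auto
  have seven: "15988 / 10000 \<le> mean_overhead 7" "mean_overhead 7 \<le> 15989 / 10000"
    by (simp_all add: mean_overhead_def numeral_eq_Suc)
  have "mean_overhead 7 \<le> mean_overhead (7 + d) \<and>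
      mean_overhead (7 + d) \<le> mean_overhead 7 + (1 - 1 / 2 ^ d) / 127"
  proof (induction d)
    case (Suc d)
    have "mean_overhead (7 + Suc d) = mean_overhead (7 + d) + 1 / (2 ^ (8 + d) - 1)"
      by (simp add: mean_overhead_def flip: add_Suc_right) (simp add: numeral_eq_Suc)
    moreover have "0 \<le> 1 / (2 ^ (8 + d) - 1 :: real)"
      by simp
    moreover have "1 / (2 ^ (8 + d) - 1 :: real) \<le> 1 / (254 * 2 ^ d)"
    proof -
      have "(1::real) \<le> 2 ^ d"
        by simp
      moreover have "(2::real) ^ (8 + d) = 256 * 2 ^ d"
        by (simp add: power_add)
      ultimately have "254 * 2 ^ d \<le> (2 ^ (8 + d) - 1 :: real)"
        by linarith
      then show ?thesis
        by (intro divide_left_mono mult_pos_pos) (auto intro: less_le_trans[of _ "254 * 2 ^ d"])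
    qed
    moreover have "(1 - 1 / 2 ^ Suc d) / 127 = (1 - 1 / 2 ^ d) / 127 + 1 / (254 * 2 ^ d :: real)"
      by (simp add: field_simps)
    ultimately show ?case
      using Suc.IH by linarith
  qed simp
  moreover have "(1 - 1 / 2 ^ d) / 127 \<le> (1 / 127 :: real)"
    by (simp add: field_simps)
  ultimately have "\<bar>mean_overhead N - 1.6\<bar> \<le> 1 / 100"
    using seven unfolding N abs_le_iff by (intro conjI) linarith+
  then show ?thesis
    by (rule order_trans) simp
qed

section \<open>The time to the first incidence\<close>

lemma incidence_block_ge_iff:
  assumes "infinite {k. asynchronized R k w}"
  shows "k \<le> incidence_block R m w \<longleftrightarrow> incidences_before (asynchronized R) k w \<le> m"
  unfolding incidence_block_def by (rule incidences_before_le_iff[of "asynchronized R" w k m, OF assms, symmetric])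

lemma finite_incidence_interval:
  assumes "infinite {k. asynchronized R k w}"
  shows "finite {k. incidences_before (asynchronized R) k w = m}"
  by (rule finite_subset[of _ "{..incidence_block R m w}"]) (auto simp: incidence_block_ge_iff[OF assms])

lemma incidence_time_0:
  assumes "infinite {k. asynchronized R k w}"
  shows "incidence_time \<tau> R 0 w
    = \<tau> * real (\<Sum>k | incidences_before (asynchronized R) k w = 0. final_slot R k w)"
proof -
  have "{..incidence_block R 0 w} = {k. incidences_before (asynchronized R) k w = 0}"
    by (auto simp: incidence_block_ge_iff[OF assms])
  then show ?thesis
    by (simp add: incidence_time_def sum_distrib_left)
qed

lemma incidence_time_diff:
  assumes "infinite {k. asynchronized R k w}"
  shows "incidence_time \<tau> R (Suc m) w - incidence_time \<tau> R m w
    = \<tau> * real (\<Sum>k | incidences_before (asynchronized R) k w = Suc m. final_slot R k w)"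
proof -
  have "{..incidence_block R (Suc m) w}
      = {..incidence_block R m w} \<union> {k. incidences_before (asynchronized R) k w = Suc m}"
    by (auto simp: incidence_block_ge_iff[OF assms] le_Suc_eq)
  moreover have "{..incidence_block R m w} \<inter> {k. incidences_before (asynchronized R) k w = Suc m} = {}"
    by (auto simp: incidence_block_ge_iff[OF assms])
  ultimately show ?thesis
    using finite_incidence_interval[OF assms]
    by (simp add: incidence_time_def sum_distrib_left sum.union_disjoint)
qed

context rlnc_model
begin

lemma measurable_incidence_time: "incidence_time \<tau> R m \<in> borel_measurable M"
proof -
  have L: "final_slot R k \<in> measurable M (count_space UNIV)" for k
    by (intro measurable_final_slot measurable_source_var)
  have block: "incidence_block R m \<in> measurable M (count_space UNIV)"
    unfolding incidence_block_def[abs_def]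
    by (intro measurable_enumerate measurable_asynchronized measurable_source_var)
  have "(\<lambda>w. \<Sum>k\<le>n. \<tau> * real (final_slot R k w)) \<in> borel_measurable M" for n
    by (intro borel_measurable_sum borel_measurable_times borel_measurable_const measurable_compose[OF L]) simp
  from measurable_compose_countable[OF this block] show ?thesis
    unfolding incidence_time_def[abs_def] .
qed

text \<open>
  The reward of a block is its number of slots, each lasting \<open>\<tau>\<close>. The duration is passed as an arbitrary \<open>f\<close> that
  agrees with the sum over the interval where infinitely many incidences occur, because the
  time of the first incidence and the differences of later ones are different terms.
\<close>

lemma interval_has_bochner_integral:
  assumes "\<tau> > 0" "0 \<le> \<mu>" "0 < p"
    and mean: "\<And>k. (\<integral>\<^sup>+w. of_nat (final_slot R k w) \<partial>M) = ennreal \<mu>"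
    and p: "\<And>k. asy_prob M R k = p"
    and f: "f \<in> borel_measurable M"
    and f_eq: "\<And>w. infinite {k. asynchronized R k w} \<Longrightarrow>
      f w = \<tau> * real (\<Sum>k | incidences_before (asynchronized R) k w = m. final_slot R k w)"
  shows "has_bochner_integral M f (\<tau> * (\<mu> / p))"
proof -
  let ?N = "incidences_before (asynchronized R)"
  let ?slots = "\<lambda>w. \<Sum>k. of_nat (if ?N k w = m then final_slot R k w else 0) :: ennreal"
  note renewal = renewal_reward[OF block_indep mean \<open>0 \<le> \<mu>\<close> p[unfolded asy_prob_def] \<open>0 < p\<close>]
  have [measurable]: "final_slot R k \<in> measurable M (count_space UNIV)"
    "?N k \<in> measurable M (count_space UNIV)" for k
    by (intro measurable_final_slot measurable_incidences_before measurable_asynchronized measurable_source_var)+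
  have AE: "AE w in M. 0 \<le> f w \<and> ennreal (f w) = ennreal \<tau> * ?slots w"
    using renewal(1)
  proof eventually_elim
    case (elim w)
    have "?slots w = (\<Sum>k | ?N k w = m. of_nat (if ?N k w = m then final_slot R k w else 0))"
      by (rule suminf_finite[OF finite_incidence_interval[OF elim]]) auto
    also have "\<dots> = of_nat (\<Sum>k | ?N k w = m. final_slot R k w)"
      by simp
    also have "\<dots> = ennreal (real (\<Sum>k | ?N k w = m. final_slot R k w))"
      by (rule ennreal_of_nat_eq_real_of_nat)
    finally show ?case
      using \<open>\<tau> > 0\<close> by (simp add: f_eq[OF elim] ennreal_mult sum_nonneg del: of_nat_sum)
  qed
  have "(\<integral>\<^sup>+w. ennreal (f w) \<partial>M) = (\<integral>\<^sup>+w. ennreal \<tau> * ?slots w \<partial>M)"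
    using AE by (intro nn_integral_cong_AE) auto
  also have "\<dots> = ennreal \<tau> * (\<integral>\<^sup>+w. ?slots w \<partial>M)"
    by (rule nn_integral_cmult) measurable
  also have "\<dots> = ennreal (\<tau> * (\<mu> / p))"
    unfolding renewal(2) using assms(1-3) by (subst ennreal_mult) auto
  finally show ?thesis
    using AE f assms(1-3) by (intro has_bochner_integral_nn_integral) auto
qed

end

theorem corollary1:
  fixes M :: "'w measure" and R :: "('w, 'n::finite) rlnc"
    and \<tau>\<^sub>q P\<^sub>B P\<^sub>E P\<^sub>a\<^sub>s\<^sub>y mean_ack \<tau>\<^sub>a\<^sub>s\<^sub>y :: real and N D b :: nat
  assumes model: "rlnc_model M R P\<^sub>B P\<^sub>E D"
    and "\<tau>\<^sub>q > 0" and "P\<^sub>B > 0"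
    and N: "N = CARD('n)"
    and P_asy: "P\<^sub>a\<^sub>s\<^sub>y = asy_prob M R b" "P\<^sub>a\<^sub>s\<^sub>y > 0"
    and mean_ack: "integrable M (\<lambda>w. real (ack R b w))" "mean_ack = (\<integral>w. real (ack R b w) \<partial>M)"
    and tau_asy: "\<tau>\<^sub>a\<^sub>s\<^sub>y = (\<integral>w. incidence_time \<tau>\<^sub>q R 0 w \<partial>M)"
  shows "(AE w in M. (\<forall>k. \<exists>t. matrix_rank (bob_matrix R k t w) = N) \<and>
            infinite {k. asynchronized R k w})
       \<and> integrable M (incidence_time \<tau>\<^sub>q R 0)
       \<and> \<tau>\<^sub>a\<^sub>s\<^sub>y = \<tau>\<^sub>q / P\<^sub>a\<^sub>s\<^sub>y * ((N + mean_overhead N) / P\<^sub>B + mean_ack)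
       \<and> \<bar>\<tau>\<^sub>a\<^sub>s\<^sub>y - \<tau>\<^sub>q / P\<^sub>a\<^sub>s\<^sub>y * ((N + 1.6) / P\<^sub>B + mean_ack)\<bar>
           \<le> \<tau>\<^sub>q / P\<^sub>a\<^sub>s\<^sub>y * (max (1 / 100) (4 / 3 / 2 ^ N) / P\<^sub>B)
       \<and> (\<forall>m. has_bochner_integral M
            (\<lambda>w. incidence_time \<tau>\<^sub>q R (Suc m) w - incidence_time \<tau>\<^sub>q R m w) \<tau>\<^sub>a\<^sub>s\<^sub>y)"
proof -
  interpret rlnc_model M R P\<^sub>B P\<^sub>E D
    by (rule model)
  define \<mu> where "\<mu> = (N + mean_overhead N) / P\<^sub>B + mean_ack"
  have mean: "(\<integral>\<^sup>+w. of_nat (final_slot R k w) \<partial>M) = ennreal \<mu>" for k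
    unfolding \<mu>_def N mean_ack(2) by (rule expected_final_slot[OF \<open>P\<^sub>B > 0\<close> mean_ack(1)])
  have "0 \<le> mean_overhead N"
    by (auto simp: mean_overhead_def intro!: sum_nonneg)
  then have "0 \<le> \<mu>"
    unfolding \<mu>_def mean_ack(2) using \<open>P\<^sub>B > 0\<close> by (intro add_nonneg_nonneg divide_nonneg_pos integral_nonneg) auto
  have p: "asy_prob M R k = P\<^sub>a\<^sub>s\<^sub>y" for k
    unfolding P_asy(1) by (rule asy_prob_identical)
  note integral = interval_has_bochner_integral[OF \<open>\<tau>\<^sub>q > 0\<close> \<open>0 \<le> \<mu>\<close> \<open>P\<^sub>a\<^sub>s\<^sub>y > 0\<close> mean p]
  have first: "has_bochner_integral M (incidence_time \<tau>\<^sub>q R 0) (\<tau>\<^sub>q * (\<mu> / P\<^sub>a\<^sub>s\<^sub>y))"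
    by (rule integral[OF measurable_incidence_time incidence_time_0])
  then have tau: "\<tau>\<^sub>a\<^sub>s\<^sub>y = \<tau>\<^sub>q * (\<mu> / P\<^sub>a\<^sub>s\<^sub>y)"
    unfolding tau_asy by (rule has_bochner_integral_integral_eq)
  have next_one: "has_bochner_integral M (\<lambda>w. incidence_time \<tau>\<^sub>q R (Suc m) w - incidence_time \<tau>\<^sub>q R m w) \<tau>\<^sub>a\<^sub>s\<^sub>y" for m
    unfolding tau
    by (rule integral[OF borel_measurable_diff[OF measurable_incidence_time measurable_incidence_time] incidence_time_diff])
  have "AE w in M. infinite {k. asynchronized R k w}"
    by (rule renewal_reward(1)[OF block_indep mean \<open>0 \<le> \<mu>\<close> p[unfolded asy_prob_def] \<open>P\<^sub>a\<^sub>s\<^sub>y > 0\<close>])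
  then have "AE w in M. (\<forall>k. \<exists>t. matrix_rank (bob_matrix R k t w) = N) \<and> infinite {k. asynchronized R k w}"
    using AE_decodable[OF \<open>P\<^sub>B > 0\<close>] unfolding N by eventually_elim blast
  moreover have "\<bar>\<tau>\<^sub>a\<^sub>s\<^sub>y - \<tau>\<^sub>q / P\<^sub>a\<^sub>s\<^sub>y * ((N + 1.6) / P\<^sub>B + mean_ack)\<bar>
      \<le> \<tau>\<^sub>q / P\<^sub>a\<^sub>s\<^sub>y * (max (1 / 100) (4 / 3 / 2 ^ N) / P\<^sub>B)"
  proof -
    have "\<tau>\<^sub>a\<^sub>s\<^sub>y - \<tau>\<^sub>q / P\<^sub>a\<^sub>s\<^sub>y * ((N + 1.6) / P\<^sub>B + mean_ack)
        = \<tau>\<^sub>q / P\<^sub>a\<^sub>s\<^sub>y * ((mean_overhead N - 1.6) / P\<^sub>B)"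
      unfolding tau \<mu>_def by (simp add: add_divide_distrib diff_divide_distrib algebra_simps)
    also have "\<bar>\<dots>\<bar> = \<tau>\<^sub>q / P\<^sub>a\<^sub>s\<^sub>y * (\<bar>mean_overhead N - 1.6\<bar> / P\<^sub>B)"
      using \<open>\<tau>\<^sub>q > 0\<close> \<open>P\<^sub>B > 0\<close> \<open>P\<^sub>a\<^sub>s\<^sub>y > 0\<close> by (simp add: abs_mult abs_divide)
    finally show ?thesis
      using mean_overhead_error[of N] \<open>\<tau>\<^sub>q > 0\<close> \<open>P\<^sub>B > 0\<close> \<open>P\<^sub>a\<^sub>s\<^sub>y > 0\<close>
      by (simp only:, intro mult_left_mono divide_right_mono) (auto simp: N Suc_le_eq)
  qed
  ultimately show ?thesis
    using first next_one tau by (auto simp: \<mu>_def integrable.intros)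
qed

end
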